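(* The Top-$k$-Position Monitoring algorithm described in the context, using the randomized MaximumProtocol (and its analogous MinimumProtocol) described there, is a randomized $O\big((\log\Delta+k)\cdot\log n\big)$-competitive algorithm for Top-$k$-Position Monitoring, where $\Delta=\max_t\,(v_{(k)}^t-v_{(k+1)}^t)$ and $v_{(k)}^t,v_{(k+1)}^t$ are the $k$-th and $(k+1)$-st largest values among $v_1^t,\dots,v_n^t$.
   Context: Model: $n$ nodes with IDs $1,\dots,n$ and one coordinator. Node $i$ observes an online stream $v_i^1,v_i^2,\dots\in\mathbb{N}$ (it knows $v_i^t$ at time $t$ but no future values); values are pairwise distinct at every time. A node can send a message to the coordinator, the coordinator can send a message to one node or broadcast one message to all nodes; every message costs one unit. Between consecutive time steps an arbitrary communication protocol may be run. Top-$k$-Position Monitoring: at every time $t$ the coordinator must know the set (top-$k$) of IDs of the nodes holding the $k$ largest values at time $t$. Filters: a set of filters at time $t$ is an $n$-tuple of intervals $F_i=[l_i,u_i]\subseteq\mathbb{N}\cup\{-\infty,\infty\}$ with $v_i^t\in F_i$ such that, as long as each node's value stays in its interval, the top-$k$ set does not change. A filter-based algorithm lets the coordinator assign intervals that always form a set of filters; a node violates its filter when its value leaves its interval. OPT is an optimal offline filter-based algorithm (knowing all streams in advance), whose cost is its number of messages. A randomized online algorithm is $c$-competitive if on every instance its expected number of messages is at most $c$ times that of OPT. MaximumProtocol run by a set of $m$ nodes with parameter $N\ge m$ (logs base 2): all nodes start active, $max_{-1}=-\infty$; for rounds $r=0,\dots,\log N$, each active node with value below $max_{r-1}$ does nothing,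 every other active node independently sends its ID and value to the coordinator with probability $2^r/N$ and on sending becomes inactive; at the end of each round the coordinator broadcasts the maximum $max_r$ received so far. The MinimumProtocol is the analogous protocol for the minimum. Monitoring algorithm. FilterReset (also run at time $0$): the coordinator applies the MaximumProtocol $k+1$ times, each time to all nodes not yet found, learning the $k+1$ largest values; it broadcasts the midpoint $M$ between the $k$-th and $(k+1)$-st largest values; top-$k$ nodes set filters $[M,\infty]$, others $[-\infty,M]$; $T^+$ is initialised to the $k$-th and $T^-$ to the $(k+1)$-st largest value. At each time $t>0$: violating nodes that were in top-$k$ at time $t-1$ run the MinimumProtocol among themselves, violating nodes not in top-$k$ at $t-1$ run the MaximumProtocol among themselves. If any value was communicated, the coordinator: lets $min$/$max$ be the values so obtained (if any); if $max$ is not set, computes it by the MaximumProtocol on all nodes not in top-$k$ at $t-1$, otherwise computes $min$ by the MinimumProtocol on all nodes in top-$k$ at $t-1$; updates $T^+\leftarrow\min(T^+,min)$, $T^-\leftarrow\max(T^-,max)$; if $T^+<T^-$ calls FilterReset, otherwise broadcasts the midpoint $M$ of $[T^-,T^+]$ and nodes set filters $[M,\infty]$ (top-$k$) or $[-\infty,M]$ (others). *)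

theory Defs
  imports "HOL-Probability.Probability" "HOL-Probability.Product_PMF" "HOL-Library.Extended"
begin

text \<open>
  Node IDs are \<open>1, \<dots>, n\<close>. A stream of observations is \<open>v :: nat \<Rightarrow> nat \<Rightarrow> nat\<close>, with \<open>v t i\<close> the
  value of node \<open>i\<close> at time \<open>t\<close>. An instance consists of the observations at times \<open>0, \<dots>, T\<close>,
  where time \<open>0\<close> is the first observation (the one on which the algorithm is initialised) and
  the horizon \<open>T\<close> is arbitrary.
\<close>

definition monitoring_instance :: "nat \<Rightarrow> nat \<Rightarrow> (nat \<Rightarrow> nat \<Rightarrow> nat) \<Rightarrow> nat \<Rightarrow> bool" where
  "monitoring_instance n k v T \<longleftrightarrow>
     1 \<le> k \<and> k < n \<and> (\<forall>t\<le>T. inj_on (v t) {1..n})"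

definition kth_largest :: "nat \<Rightarrow> nat \<Rightarrow> (nat \<Rightarrow> nat) \<Rightarrow> nat" where
  "kth_largest n k x = rev (sort (map x [1..<Suc n])) ! (k - 1)"

definition top_k :: "nat \<Rightarrow> nat \<Rightarrow> (nat \<Rightarrow> nat) \<Rightarrow> nat set" where
  "top_k n k x = {i \<in> {1..n}. kth_largest n k x \<le> x i}"

definition max_gap :: "nat \<Rightarrow> nat \<Rightarrow> (nat \<Rightarrow> nat \<Rightarrow> nat) \<Rightarrow> nat \<Rightarrow> nat" where
  "max_gap n k v T =
     Max ((\<lambda>t. kth_largest n k (v t) - kth_largest n (Suc k) (v t)) ` {0..T})"


section \<open>Filters\<close>

type_synonym filt = "nat extended \<times> nat extended"

definition in_filter :: "nat \<Rightarrow> filt \<Rightarrow> bool" where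
  "in_filter x F \<longleftrightarrow> fst F \<le> Fin x \<and> Fin x \<le> snd F"

text \<open>As values are pairwise distinct at every time, only such tuples \<open>y\<close> can be observed.\<close>

definition set_of_filters :: "nat \<Rightarrow> nat \<Rightarrow> (nat \<Rightarrow> nat) \<Rightarrow> (nat \<Rightarrow> filt) \<Rightarrow> bool" where
  "set_of_filters n k x F \<longleftrightarrow>
     (\<forall>i\<in>{1..n}. in_filter (x i) (F i)) \<and>
     (\<forall>y. inj_on y {1..n} \<and> (\<forall>i\<in>{1..n}. in_filter (y i) (F i)) \<longrightarrow> top_k n k y = top_k n k x)"


section \<open>Optimal offline filter-based algorithm\<close>

datatype message = To_Coordinator nat | To_Node nat | Broadcast

text \<open>
  An offline filter-based algorithm on a fixed instance amounts to the filters \<open>F t\<close> in force after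
  the communication at time \<open>t\<close> together with the messages \<open>ms t\<close> exchanged at time \<open>t\<close>. A node's
  filter can only change when the node receives a message; before any communication every node
  has the trivial filter. The content of messages is unrestricted; in particular, one broadcast may
  change all filters.
\<close>

definition offline_run ::
  "nat \<Rightarrow> nat \<Rightarrow> (nat \<Rightarrow> nat \<Rightarrow> nat) \<Rightarrow> nat \<Rightarrow> (nat \<Rightarrow> nat \<Rightarrow> filt) \<Rightarrow> (nat \<Rightarrow> message list) \<Rightarrow> bool" where
  "offline_run n k v T F ms \<longleftrightarrow>
     (\<forall>t\<le>T. set_of_filters n k (v t) (F t)) \<and>
     (\<forall>t\<le>T. \<forall>i\<in>{1..n}.
        F t i \<noteq> (if t = 0 then (Minf, Pinf) else F (t - 1) i) \<longrightarrow>
        To_Node i \<in> set (ms t) \<or> Broadcast \<in> set (ms t))"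

definition opt_messages :: "nat \<Rightarrow> nat \<Rightarrow> (nat \<Rightarrow> nat \<Rightarrow> nat) \<Rightarrow> nat \<Rightarrow> nat" where
  "opt_messages n k v T = Inf {\<Sum>t\<le>T. length (ms t) | F ms. offline_run n k v T F ms}"


section \<open>Maximum and minimum protocol\<close>

text \<open>
  The state \<open>(R, c)\<close> consists of the set \<open>R\<close> of nodes whose ID and value the coordinator has
  received in this run and the number \<open>c\<close> of messages sent so far. The active nodes are \<open>A - R\<close>,
  and the value last broadcast is the maximum of \<open>x\<close> over \<open>R\<close> (\<open>-\<infinity>\<close> if \<open>R\<close> is empty).
  The summand \<open>1\<close> is the broadcast at the end of the round.
\<close>

definition protocol_round ::
  "nat \<Rightarrow> (nat \<Rightarrow> 'b::linorder) \<Rightarrow> nat set \<Rightarrow> nat \<Rightarrow> nat set \<times> nat \<Rightarrow> (nat set \<times> nat) pmf" where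
  "protocol_round N x A r = (\<lambda>(R, c).
     let C = {i \<in> A - R. \<not> (\<exists>j\<in>R. x i < x j)}
     in map_pmf (\<lambda>b. let B = {i \<in> C. b i} in (R \<union> B, c + card B + 1))
          (Pi_pmf C False (\<lambda>_. bernoulli_pmf (min 1 (2 ^ r / real N)))))"

primrec protocol_rounds ::
  "nat \<Rightarrow> (nat \<Rightarrow> 'b::linorder) \<Rightarrow> nat set \<Rightarrow> nat \<Rightarrow> (nat set \<times> nat) pmf" where
  "protocol_rounds N x A 0 = return_pmf ({}, 0)"
| "protocol_rounds N x A (Suc r) = bind_pmf (protocol_rounds N x A r) (protocol_round N x A r)"

text \<open>
  The result is the ID of the node with the largest received value, if any, and the number of
  messages. For \<open>N\<close> not a power of two, \<open>log N\<close> is rounded up and the sending probability is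
  capped at \<open>1\<close>, so that in the last round the probability is \<open>1\<close>. If no node runs the protocol,
  nothing is sent.
\<close>

definition maximum_protocol ::
  "nat \<Rightarrow> (nat \<Rightarrow> 'b::linorder) \<Rightarrow> nat set \<Rightarrow> (nat option \<times> nat) pmf" where
  "maximum_protocol N x A =
     (if A = {} then return_pmf (None, 0)
      else map_pmf (\<lambda>(R, c). (if R = {} then None else Some (arg_max_on x R), c))
             (protocol_rounds N x A (Suc (nat \<lceil>log 2 (real N)\<rceil>))))"

definition minimum_protocol :: "nat \<Rightarrow> (nat \<Rightarrow> nat) \<Rightarrow> nat set \<Rightarrow> (nat option \<times> nat) pmf" where
  "minimum_protocol N x A = maximum_protocol N (\<lambda>i. - int (x i)) A"


section \<open>Monitoring algorithm\<close>

text \<open>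
  \<open>mid\<close> is the midpoint last broadcast, rounded down so that filter bounds are natural numbers;
  \<open>cost\<close> is the number of messages sent since time \<open>0\<close>.
\<close>

record monitor_state =
  top_set :: "nat set"
  T_plus :: nat
  T_minus :: nat
  mid :: nat
  cost :: nat

definition assigned_filter :: "monitor_state \<Rightarrow> nat \<Rightarrow> filt" where
  "assigned_filter s i = (if i \<in> top_set s then (Fin (mid s), Pinf) else (Minf, Fin (mid s)))"

text \<open>The IDs of the \<open>j\<close> largest values in decreasing order, with the number of messages used.\<close>

primrec find_largest :: "nat \<Rightarrow> nat \<Rightarrow> (nat \<Rightarrow> nat) \<Rightarrow> nat \<Rightarrow> (nat list \<times> nat) pmf" where
  "find_largest n N x 0 = return_pmf ([], 0)"
| "find_largest n N x (Suc j) = do {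
     (is, c) \<leftarrow> find_largest n N x j;
     (m, c') \<leftarrow> maximum_protocol N x ({1..n} - set is);
     return_pmf (is @ [the m], c + c')
   }"

text \<open>\<open>c0\<close> is the number of messages sent before.\<close>

definition filter_reset :: "nat \<Rightarrow> nat \<Rightarrow> nat \<Rightarrow> (nat \<Rightarrow> nat) \<Rightarrow> nat \<Rightarrow> monitor_state pmf" where
  "filter_reset n k N x c0 = map_pmf (\<lambda>(is, c).
     \<lparr> top_set = set (take k is),
       T_plus = x (is ! (k - 1)),
       T_minus = x (is ! k),
       mid = (x (is ! (k - 1)) + x (is ! k)) div 2,
       cost = c0 + c + 1 \<rparr>) (find_largest n N x (k + 1))"

text \<open>
  \<open>N_top\<close>, \<open>N_rest\<close> and \<open>N_all\<close> are the parameters of the protocols run among top-k nodes, among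
  the other nodes, and in a filter reset, respectively.
\<close>

definition monitor_step ::
  "nat \<Rightarrow> nat \<Rightarrow> nat \<Rightarrow> nat \<Rightarrow> nat \<Rightarrow> (nat \<Rightarrow> nat) \<Rightarrow> monitor_state \<Rightarrow> monitor_state pmf" where
  "monitor_step n k N_top N_rest N_all x s =
     (let S = top_set s;
          S' = {1..n} - S;
          violating = (\<lambda>i. \<not> in_filter (x i) (assigned_filter s i))
      in do {
        (mn, c1) \<leftarrow> minimum_protocol N_top x {i \<in> S. violating i};
        (mx, c2) \<leftarrow> maximum_protocol N_rest x {i \<in> S'. violating i};
        if mn = None \<and> mx = None
        then return_pmf (s\<lparr>cost := cost s + c1 + c2\<rparr>)
        else do {
          (mn', mx', c3) \<leftarrow>
            (if mx = None
             then map_pmf (\<lambda>(m, c). (mn, m, c)) (maximum_protocol N_rest x S')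
             else map_pmf (\<lambda>(m, c). (m, mx, c)) (minimum_protocol N_top x S));
          let tp = min (T_plus s) (x (the mn'));
              tm = max (T_minus s) (x (the mx'));
              c = cost s + c1 + c2 + c3
          in if tp < tm
             then filter_reset n k N_all x c
             else return_pmf
               \<lparr> top_set = S, T_plus = tp, T_minus = tm, mid = (tm + tp) div 2, cost = c + 1 \<rparr>
        }
      })"

text \<open>The state after the communication at time \<open>t\<close>.\<close>

primrec monitor ::
  "nat \<Rightarrow> nat \<Rightarrow> nat \<Rightarrow> nat \<Rightarrow> nat \<Rightarrow> (nat \<Rightarrow> nat \<Rightarrow> nat) \<Rightarrow> nat \<Rightarrow> monitor_state pmf" where
  "monitor n k N_top N_rest N_all v 0 = filter_reset n k N_all (v 0) 0"
| "monitor n k N_top N_rest N_all v (Suc t) =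
     bind_pmf (monitor n k N_top N_rest N_all v t) (monitor_step n k N_top N_rest N_all (v (Suc t)))"

text \<open>
  A protocol parameter must bound the number of participating nodes. The upper bound \<open>2 * n\<close> admits
  the number of nodes that may participate, \<open>n\<close> itself, and either of them rounded up to a power of two.
\<close>

definition admissible_parameters :: "nat \<Rightarrow> nat \<Rightarrow> nat \<Rightarrow> nat \<Rightarrow> nat \<Rightarrow> bool" where
  "admissible_parameters n k N_top N_rest N_all \<longleftrightarrow>
     N_top \<in> {k..2 * n} \<and> N_rest \<in> {n - k..2 * n} \<and> N_all \<in> {n..2 * n}"

end

theory Submission
  imports Defs
begin

text \<open>
  Protocol: a node that can still send after a round exceeds every node that sent in it. If the
  sending probability of the round is \<open>p\<close>, the expected number of such nodes is at most \<open>1 / p\<close>.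
  As the probability at most doubles, each round costs at most two
  expected messages and one broadcast, so a protocol run costs \<open>O(log n)\<close>. In the last round the
  probability is \<open>1\<close>, so the result is always the true extremum: only the cost is random.

  Between two resets, each violation at least halves \<open>T\<^sup>+ - T\<^sup>- + 1\<close>, which is at most \<open>\<Delta> + 1\<close> after a
  reset; hence there are \<open>O(log \<Delta>)\<close> violations per reset. If the offline algorithm sends no message
  between two resets, its filters are fixed in between, which forces every value of a top-k node to
  be at least every value of another node, even at different times. Then \<open>T\<^sup>-\<close> cannot exceed
  \<open>T\<^sup>+\<close>; so the offline algorithm pays for every reset.
\<close>

text \<open>Offline filters are arbitrary intervals, and \<open>set_of_filters\<close> speaks only
  of injective value tuples. Values observed at two different times can therefore be compared only
  through a third tuple that mixes them without collisions; building it is the core of the charging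
  argument. Crossings pay only for resets after time \<open>0\<close>; the initial reset is charged
  to the message at time \<open>0\<close> that every offline run needs in order to leave the trivial
  filters. Each reset grants a budget of \<open>D + 2\<close>, where \<open>D\<close> is the binary
  logarithm of the maximal gap: \<open>D + 1\<close> bounds the potential
  \<open>log 2 (tp - tm + 1)\<close> right after a reset, and the remaining unit pays for the
  violation that triggers it. The maximal gap may be \<open>1\<close>, which gives
  \<open>D = 0\<close>, so additive constants are absorbed by \<open>1 \<le> k\<close> and
  \<open>1 \<le> log 2 n\<close>.\<close>

section \<open>Auxiliary facts on probability mass functions\<close>

text \<open>The accounting rule for running one random phase after another. Nonnegative integrals
  avoid all integrability obligations, and the restriction to the support lets exactness of earlier
  results be used.\<close>

lemma nn_integral_bind_pmf_le:
  assumes "\<And>a. a \<in> set_pmf p \<Longrightarrow> (\<integral>\<^sup>+y. h y \<partial>measure_pmf (q a)) \<le> g a + K"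
    and "(\<integral>\<^sup>+a. g a \<partial>p) \<le> B"
  shows "(\<integral>\<^sup>+y. h y \<partial>bind_pmf p q) \<le> B + K"
proof -
  have "(\<integral>\<^sup>+y. h y \<partial>bind_pmf p q) \<le> (\<integral>\<^sup>+a. g a + K \<partial>p)"
    unfolding nn_integral_bind_pmf using assms(1)
    by (intro nn_integral_mono_AE) (auto simp: AE_measure_pmf_iff)
  also have "\<dots> = (\<integral>\<^sup>+a. g a \<partial>p) + K"
    by (subst nn_integral_add) auto
  finally show ?thesis using assms(2) by (meson add_right_mono order_trans)
qed

lemma nn_integral_card_pmf:
  assumes "finite C"
  shows "(\<integral>\<^sup>+b. of_nat (card {i \<in> C. P i b}) \<partial>measure_pmf M)
    = (\<Sum>i\<in>C. emeasure (measure_pmf M) {b. P i b})"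
proof -
  have "(of_nat (card {i \<in> C. P i b}) :: ennreal) = (\<Sum>i\<in>C. indicator {b. P i b} b)" for b
    using assms by (simp add: indicator_def sum.If_cases Int_def)
  then show ?thesis by (simp add: nn_integral_sum)
qed

lemma emeasure_Pi_pmf_bernoulli_single:
  assumes "finite C" "i \<in> C" "0 \<le> p" "p \<le> 1"
  shows "emeasure (measure_pmf (Pi_pmf C False (\<lambda>_. bernoulli_pmf p))) {b. b i} = ennreal p"
proof -
  have "{b. b i} = Pi C (\<lambda>j. if j = i then {True} else UNIV)"
    using assms by (auto simp: Pi_def split: if_splits)
  then have "measure_pmf.prob (Pi_pmf C False (\<lambda>_. bernoulli_pmf p)) {b. b i}
      = (\<Prod>j\<in>C. measure_pmf.prob (bernoulli_pmf p) (if j = i then {True} else UNIV))"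
    using measure_Pi_pmf_Pi[OF assms(1)] by simp
  also have "\<dots> = (\<Prod>j\<in>C. if j = i then p else 1)"
    using assms by (intro prod.cong) (auto simp: measure_pmf_single)
  finally show ?thesis
    using assms by (simp add: measure_pmf.emeasure_eq_measure)
qed

lemma emeasure_Pi_pmf_bernoulli_none:
  assumes "finite C" "D \<subseteq> C" "0 \<le> p" "p \<le> 1"
  shows "emeasure (measure_pmf (Pi_pmf C False (\<lambda>_. bernoulli_pmf p))) {b. \<forall>j\<in>D. \<not> b j}
    = ennreal ((1 - p) ^ card D)"
proof -
  have "{b. \<forall>j\<in>D. \<not> b j} = Pi C (\<lambda>j. if j \<in> D then {False} else UNIV)"
    using assms by (auto simp: Pi_def split: if_splits)
  then have "measure_pmf.prob (Pi_pmf C False (\<lambda>_. bernoulli_pmf p)) {b. \<forall>j\<in>D. \<not> b j}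
      = (\<Prod>j\<in>C. measure_pmf.prob (bernoulli_pmf p) (if j \<in> D then {False} else UNIV))"
    using measure_Pi_pmf_Pi[OF assms(1)] by simp
  also have "\<dots> = (\<Prod>j\<in>C. if j \<in> D then 1 - p else 1)"
    using assms by (intro prod.cong) (auto simp: measure_pmf_single)
  also have "\<dots> = (1 - p) ^ card D"
    using assms by (simp add: prod.If_cases Int_absorb1)
  finally show ?thesis
    by (simp add: measure_pmf.emeasure_eq_measure)
qed

text \<open>A geometric series in disguise: without ties the exponents are
  \<open>1, ..., card C\<close>, and ties only raise them. Multiplying by \<open>p\<close> instead
  of dividing keeps \<open>p = 0\<close> meaningful.\<close>

lemma sum_power_rank_le:
  fixes x :: "'a \<Rightarrow> 'b::linorder"
  assumes "finite C" "0 \<le> p" "p \<le> (1::real)"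
  shows "p * (\<Sum>i\<in>C. (1 - p) ^ card {j \<in> C. x i \<le> x j}) \<le> 1 - p"
  using assms(1)
proof (induction C rule: finite_ranking_induct[where f = x])
  case empty
  then show ?case using assms by simp
next
  case (insert m C)
  show ?case
  proof (cases "m \<in> C")
    case True
    then show ?thesis using insert by (simp add: insert_absorb)
  next
    case False
    \<comment> \<open>The inserted \<open>m\<close> has the largest value, so every earlier exponent
      grows by exactly one and the old sum is scaled by \<open>1 - p\<close>.\<close>
    have "card {j \<in> insert m C. x i \<le> x j} = Suc (card {j \<in> C. x i \<le> x j})" if "i \<in> C" for i
    proof -
      have "{j \<in> insert m C. x i \<le> x j} = insert m {j \<in> C. x i \<le> x j}"
        using insert.hyps(2)[OF that] by auto
      then show ?thesis using False insert.hyps(1) by simp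
    qed
    then have *: "(\<Sum>i\<in>C. (1 - p) ^ card {j \<in> insert m C. x i \<le> x j})
        = (1 - p) * (\<Sum>i\<in>C. (1 - p) ^ card {j \<in> C. x i \<le> x j})"
      by (simp add: sum_distrib_left)
    have "card {j \<in> insert m C. x m \<le> x j} \<ge> 1"
      using insert.hyps(1) by (auto simp: Suc_le_eq card_gt_0_iff)
    then have "(1 - p) ^ card {j \<in> insert m C. x m \<le> x j} \<le> (1 - p) ^ 1"
      using assms by (intro power_decreasing) auto
    then have "(\<Sum>i\<in>insert m C. (1 - p) ^ card {j \<in> insert m C. x i \<le> x j})
        \<le> (1 - p) + (1 - p) * (\<Sum>i\<in>C. (1 - p) ^ card {j \<in> C. x i \<le> x j})"
      using False insert.hyps(1) * by simp
    then have "p * (\<Sum>i\<in>insert m C. (1 - p) ^ card {j \<in> insert m C. x i \<le> x j})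
        \<le> p * ((1 - p) + (1 - p) * (\<Sum>i\<in>C. (1 - p) ^ card {j \<in> C. x i \<le> x j}))"
      using assms by (intro mult_left_mono) auto
    also have "\<dots> = p * (1 - p) + (1 - p) * (p * (\<Sum>i\<in>C. (1 - p) ^ card {j \<in> C. x i \<le> x j}))"
      by (simp add: algebra_simps)
    also have "\<dots> \<le> p * (1 - p) + (1 - p) * (1 - p)"
      using insert.IH assms by (intro add_left_mono mult_left_mono) auto
    also have "\<dots> = 1 - p" by (simp add: algebra_simps)
    finally show ?thesis .
  qed
qed

section \<open>Maximum and minimum protocol\<close>

text \<open>The set \<open>C\<close> inside \<open>protocol_round\<close>: the nodes that toss a
  coin in the next round. It is named so that its expected size can be followed from round to
  round.\<close>

definition candidates :: "(nat \<Rightarrow> 'b::linorder) \<Rightarrow> nat set \<Rightarrow> nat set \<Rightarrow> nat set" where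
  "candidates x A R = {i \<in> A - R. \<not> (\<exists>j\<in>R. x i < x j)}"

definition sending_prob :: "nat \<Rightarrow> nat \<Rightarrow> real" where
  "sending_prob N r = min 1 (2 ^ r / real N)"

lemma sending_prob_bounds: "0 \<le> sending_prob N r" "sending_prob N r \<le> 1"
  by (auto simp: sending_prob_def)

text \<open>Only an inequality, because the cap at \<open>1\<close> can stop the doubling.\<close>

lemma sending_prob_Suc_le: "sending_prob N (Suc r) \<le> 2 * sending_prob N r"
proof -
  have "2 * sending_prob N r = min 2 (2 ^ Suc r / real N)"
    by (simp add: sending_prob_def min_mult_distrib_left)
  then show ?thesis by (simp add: sending_prob_def min_def)
qed

section \<open>Expected number of messages in the protocol rounds\<close>

lemma protocol_round_eq:
  "protocol_round N x A r (R, c) =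
     map_pmf (\<lambda>b. (R \<union> {i \<in> candidates x A R. b i}, c + card {i \<in> candidates x A R. b i} + 1))
       (Pi_pmf (candidates x A R) False (\<lambda>_. bernoulli_pmf (sending_prob N r)))"
  by (simp add: protocol_round_def candidates_def sending_prob_def Let_def)

lemma expected_cost_protocol_round:
  assumes "finite A"
  shows "(\<integral>\<^sup>+y. of_nat (snd y) \<partial>protocol_round N x A r (R, c))
    = of_nat c + ennreal (sending_prob N r) * of_nat (card (candidates x A R)) + 1"
proof -
  let ?C = "candidates x A R"
  let ?M = "Pi_pmf ?C False (\<lambda>_. bernoulli_pmf (sending_prob N r))"
  have fin: "finite ?C" using assms by (simp add: candidates_def)
  have "(\<integral>\<^sup>+b. of_nat (card {i \<in> ?C. b i}) \<partial>?M) = ennreal (sending_prob N r) * of_nat (card ?C)"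
    using fin sending_prob_bounds
    by (simp add: nn_integral_card_pmf emeasure_Pi_pmf_bernoulli_single mult.commute)
  then show ?thesis
    by (simp add: protocol_round_eq nn_integral_add)
qed

text \<open>Of the candidates, node \<open>i\<close> survives a round iff no candidate with a value at least \<open>x i\<close>
  sends; this has probability \<open>(1 - p) ^ j\<close> for the \<open>j\<close>-th largest candidate.\<close>

lemma expected_candidates_protocol_round:
  assumes "finite A" "inj_on x A"
  shows "ennreal (sending_prob N r) *
      (\<integral>\<^sup>+y. of_nat (card (candidates x A (fst y))) \<partial>protocol_round N x A r (R, c)) \<le> 1"
proof -
  let ?C = "candidates x A R" and ?p = "sending_prob N r"
  let ?M = "Pi_pmf ?C False (\<lambda>_. bernoulli_pmf ?p)"
  have fin: "finite ?C" using assms by (simp add: candidates_def)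
  have "candidates x A (R \<union> {i \<in> ?C. b i}) = {i \<in> ?C. \<forall>j\<in>{j \<in> ?C. x i \<le> x j}. \<not> b j}" for b
  proof (intro equalityI subsetI)
    fix i assume i: "i \<in> candidates x A (R \<union> {i \<in> ?C. b i})"
    have "\<not> b j" if "j \<in> ?C" "x i \<le> x j" for j
    proof (cases "j = i")
      case False
      \<comment> \<open>Injectivity matters here: a sender with an equal value would not remove
        \<open>i\<close> from the candidates.\<close>
      then have "x i \<noteq> x j" using that(1) i assms(2) by (auto simp: candidates_def inj_on_def)
      then have "x i < x j" using that(2) by simp
      moreover have "\<forall>j\<in>{i \<in> ?C. b i}. \<not> x i < x j" using i
        unfolding candidates_def[of x A "R \<union> {i \<in> ?C. b i}"] by simp
      ultimately show ?thesis using that(1) by blast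
    qed (use i that in \<open>auto simp: candidates_def\<close>)
    then show "i \<in> {i \<in> ?C. \<forall>j\<in>{j \<in> ?C. x i \<le> x j}. \<not> b j}"
      using i by (auto simp: candidates_def)
  next
    fix i assume "i \<in> {i \<in> ?C. \<forall>j\<in>{j \<in> ?C. x i \<le> x j}. \<not> b j}"
    then have i: "i \<in> ?C" and none: "\<And>j. j \<in> ?C \<Longrightarrow> x i \<le> x j \<Longrightarrow> \<not> b j" by auto
    have "\<not> x i < x j" if "j \<in> R \<union> {i \<in> ?C. b i}" for j
    proof (cases "j \<in> R")
      case True
      then show ?thesis using i by (simp add: candidates_def)
    next
      case False
      then show ?thesis using that none[of j] by (auto dest: less_imp_le)
    qed
    moreover have "i \<in> A - (R \<union> {i \<in> ?C. b i})" using i none[of i] by (simp add: candidates_def)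
    ultimately show "i \<in> candidates x A (R \<union> {i \<in> ?C. b i})"
      unfolding candidates_def[of x A "R \<union> {i \<in> ?C. b i}"] by simp
  qed
  then have "(\<integral>\<^sup>+y. of_nat (card (candidates x A (fst y))) \<partial>protocol_round N x A r (R, c))
      = (\<integral>\<^sup>+b. of_nat (card {i \<in> ?C. \<forall>j\<in>{j \<in> ?C. x i \<le> x j}. \<not> b j}) \<partial>?M)"
    by (simp add: protocol_round_eq)
  also have "\<dots> = (\<Sum>i\<in>?C. ennreal ((1 - ?p) ^ card {j \<in> ?C. x i \<le> x j}))"
    unfolding nn_integral_card_pmf[OF fin]
    by (intro sum.cong refl emeasure_Pi_pmf_bernoulli_none fin sending_prob_bounds) auto
  also have "\<dots> = ennreal (\<Sum>i\<in>?C. (1 - ?p) ^ card {j \<in> ?C. x i \<le> x j})"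
    using sending_prob_bounds by (intro sum_ennreal) auto
  also have "ennreal ?p * \<dots> = ennreal (?p * (\<Sum>i\<in>?C. (1 - ?p) ^ card {j \<in> ?C. x i \<le> x j}))"
    using sending_prob_bounds by (intro ennreal_mult[symmetric] sum_nonneg) auto
  also have "\<dots> \<le> ennreal 1"
    using order_trans[OF sum_power_rank_le[OF fin sending_prob_bounds(1,2)[of N r], of x]]
      sending_prob_bounds(1)
    by (intro ennreal_leI) simp
  finally show ?thesis by simp
qed

text \<open>The second conjunct bounds the expected senders of the coming round \<open>r\<close> by
  \<open>2\<close>; with the broadcast this gives \<open>3\<close> per round. It starts from
  \<open>card A \<le> N\<close> and continues because
  \<open>expected_candidates_protocol_round\<close> gives \<open>1\<close> for the old probability
  and the new one is at most twice as large.\<close>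

lemma expected_protocol_rounds:
  assumes "finite A" "card A \<le> N" "inj_on x A"
  shows "(\<integral>\<^sup>+y. of_nat (snd y) \<partial>protocol_rounds N x A r) \<le> of_nat (3 * r) \<and>
    ennreal (sending_prob N r) *
      (\<integral>\<^sup>+y. of_nat (card (candidates x A (fst y))) \<partial>protocol_rounds N x A r) \<le> 2"
proof (induction r)
  case 0
  have "sending_prob N 0 * real (card A) \<le> 1"
    using assms(2) by (cases "N = 0") (auto simp: sending_prob_def min_def field_simps)
  then have "ennreal (sending_prob N 0) * of_nat (card A) \<le> 1"
    using sending_prob_bounds
    by (simp add: ennreal_of_nat_eq_real_of_nat flip: ennreal_mult)
  then have "ennreal (sending_prob N 0) * of_nat (card A) \<le> 2"
    by (rule order_trans) simp
  then show ?case by (simp add: candidates_def)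
next
  case (Suc r)
  have "(\<integral>\<^sup>+y. of_nat (snd y) \<partial>protocol_rounds N x A (Suc r))
      = (\<integral>\<^sup>+y. of_nat (snd y) + ennreal (sending_prob N r) *
          of_nat (card (candidates x A (fst y))) + 1 \<partial>protocol_rounds N x A r)"
    unfolding protocol_rounds.simps nn_integral_bind_pmf
  proof (intro nn_integral_cong)
    show "(\<integral>\<^sup>+z. of_nat (snd z) \<partial>protocol_round N x A r y) = of_nat (snd y) +
        ennreal (sending_prob N r) * of_nat (card (candidates x A (fst y))) + 1" for y
      using expected_cost_protocol_round[OF assms(1), of N x r "fst y" "snd y"] by simp
  qed
  also have "\<dots> = (\<integral>\<^sup>+y. of_nat (snd y) \<partial>protocol_rounds N x A r) + ennreal (sending_prob N r) *
      (\<integral>\<^sup>+y. of_nat (card (candidates x A (fst y))) \<partial>protocol_rounds N x A r) + 1"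
    by (simp add: nn_integral_add nn_integral_cmult)
  also have "\<dots> \<le> of_nat (3 * r) + 2 + 1"
    using Suc by (intro add_mono) auto
  also have "\<dots> = of_nat (3 * Suc r)" by (simp add: add.commute)
  finally have 1: "(\<integral>\<^sup>+y. of_nat (snd y) \<partial>protocol_rounds N x A (Suc r)) \<le> of_nat (3 * Suc r)" .
  let ?f = "\<lambda>y. \<integral>\<^sup>+z. of_nat (card (candidates x A (fst z))) \<partial>protocol_round N x A r y"
  have "ennreal (sending_prob N (Suc r)) *
      (\<integral>\<^sup>+y. of_nat (card (candidates x A (fst y))) \<partial>protocol_rounds N x A (Suc r))
      \<le> 2 * ennreal (sending_prob N r) * (\<integral>\<^sup>+y. ?f y \<partial>protocol_rounds N x A r)"
    unfolding protocol_rounds.simps nn_integral_bind_pmf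
  proof (rule mult_right_mono)
    have "ennreal (sending_prob N (Suc r)) \<le> ennreal (2 * sending_prob N r)"
      by (rule ennreal_leI[OF sending_prob_Suc_le])
    also have "\<dots> = 2 * ennreal (sending_prob N r)"
      by (simp add: ennreal_mult')
    finally show "ennreal (sending_prob N (Suc r)) \<le> 2 * ennreal (sending_prob N r)" .
  qed simp
  also have "\<dots> = 2 * (\<integral>\<^sup>+y. ennreal (sending_prob N r) * ?f y \<partial>protocol_rounds N x A r)"
    by (simp add: nn_integral_cmult mult.assoc)
  also have "\<dots> \<le> 2 * (\<integral>\<^sup>+y. 1 \<partial>protocol_rounds N x A r)"
  proof (intro mult_left_mono nn_integral_mono)
    show "ennreal (sending_prob N r) * ?f y \<le> 1" for y
      using expected_candidates_protocol_round[OF assms(1,3), of N r "fst y" "snd y"] by simp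
  qed simp
  finally show ?case using 1 by simp
qed

section \<open>Exactness of the returned extremum\<close>

lemma protocol_rounds_subset:
  "y \<in> set_pmf (protocol_rounds N x A r) \<Longrightarrow> fst y \<subseteq> A"
proof (induction r arbitrary: y)
  case (Suc r)
  then obtain R c where "(R, c) \<in> set_pmf (protocol_rounds N x A r)"
      "y \<in> set_pmf (protocol_round N x A r (R, c))"
    by auto
  moreover from Suc.IH[OF this(1)] have "R \<subseteq> A" by simp
  ultimately show ?case by (auto simp: protocol_round_eq candidates_def)
qed simp

lemma protocol_round_certain:
  assumes "finite A" "sending_prob N r = 1" "y \<in> set_pmf (protocol_round N x A r (R, c))"
  shows "fst y = R \<union> candidates x A R"
proof -
  let ?C = "candidates x A R"
  have "finite ?C" using assms by (simp add: candidates_def)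
  obtain b where b: "b \<in> set_pmf (Pi_pmf ?C False (\<lambda>_. bernoulli_pmf 1))"
      "fst y = R \<union> {i \<in> ?C. b i}"
    using assms(2,3) unfolding protocol_round_eq by auto
  have "z \<in> set_pmf (bernoulli_pmf 1) \<longleftrightarrow> z" for z
    by (cases z) (simp_all add: set_pmf_iff)
  then have "b i" if "i \<in> ?C" for i
    using b(1) that \<open>finite ?C\<close> by (simp add: set_Pi_pmf PiE_dflt_def)
  then have "{i \<in> ?C. b i} = ?C" by blast
  then show ?thesis using b(2) by simp
qed

lemma le_two_power_ceiling_log:
  assumes "N \<ge> 1" shows "real N \<le> 2 ^ nat \<lceil>log 2 (real N)\<rceil>"
proof -
  have "real N = 2 powr log 2 (real N)" using assms by simp
  also have "\<dots> \<le> 2 powr real (nat \<lceil>log 2 (real N)\<rceil>)"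
    by (intro powr_mono real_nat_ceiling_ge) auto
  finally show ?thesis by (simp add: powr_realpow)
qed

text \<open>The node with the true maximum is never below a broadcast value, so before the last
  round it has either sent already or is still a candidate; in that round every candidate sends.
  Injectivity makes \<open>arg_max_on\<close> pick this very node.\<close>

lemma maximum_protocol_correct:
  fixes x :: "nat \<Rightarrow> 'b::linorder"
  assumes "finite A" "N \<ge> 1" "inj_on x A" "y \<in> set_pmf (maximum_protocol N x A)"
  shows "if A = {} then y = (None, 0)
    else \<exists>m\<in>A. fst y = Some m \<and> (\<forall>j\<in>A. x j \<le> x m)"
proof (cases "A = {}")
  case True
  then show ?thesis using assms by (simp add: maximum_protocol_def)
next
  case False
  let ?L = "nat \<lceil>log 2 (real N)\<rceil>"
  have "1 \<le> 2 ^ ?L / real N"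
    using le_two_power_ceiling_log[OF assms(2)] assms(2) by (simp add: field_simps)
  then have p: "sending_prob N ?L = 1" by (simp add: sending_prob_def)
  have "y \<in> (\<lambda>(R, c). (if R = {} then None else Some (arg_max_on x R), c)) `
      set_pmf (protocol_rounds N x A (Suc ?L))"
    using assms(4) False by (simp add: maximum_protocol_def del: protocol_rounds.simps)
  then obtain R' c' where R': "(R', c') \<in> set_pmf (protocol_rounds N x A (Suc ?L))"
      "fst y = (if R' = {} then None else Some (arg_max_on x R'))"
    by (auto simp del: protocol_rounds.simps)
  then obtain R c where R: "(R, c) \<in> set_pmf (protocol_rounds N x A ?L)"
      "(R', c') \<in> set_pmf (protocol_round N x A ?L (R, c))"
    by auto
  have eq: "R' = R \<union> candidates x A R"
    using protocol_round_certain[OF assms(1) p R(2)] by simp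
  have "R \<subseteq> A" using protocol_rounds_subset[OF R(1)] by simp
  then have sub: "R' \<subseteq> A" using eq by (auto simp: candidates_def)
  have "Max (x ` A) \<in> x ` A" using assms(1) False by (intro Max_in) auto
  then obtain m where "m \<in> A" "x m = Max (x ` A)" by auto
  then have m: "m \<in> A" "\<forall>j\<in>A. x j \<le> x m" using assms(1) by auto
  have "\<not> x m < x j" if "j \<in> R" for j
    using that m(2) \<open>R \<subseteq> A\<close> by (auto simp: not_less)
  then have "m \<in> R'" using m(1) by (simp add: eq candidates_def)
  have "arg_max_on x R' = m"
    unfolding arg_max_on_def
  proof (rule arg_maxI)
    show "m \<in> R'" by fact
    show "\<not> x j > x m" if "j \<in> R'" for j using that sub m by (auto simp: not_less)
    show "j = m" if "j \<in> R'" "\<forall>y. y \<in> R' \<longrightarrow> \<not> x y > x j" for j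
    proof -
      have "x m \<le> x j" using that(2) \<open>m \<in> R'\<close> by (simp add: not_less)
      moreover have "j \<in> A" using that(1) sub by auto
      ultimately have "x j = x m" using m(2) by (simp add: order_antisym)
      then show ?thesis using \<open>j \<in> A\<close> m(1) assms(3) by (simp add: inj_on_eq_iff)
    qed
  qed
  moreover have "R' \<noteq> {}" using \<open>m \<in> R'\<close> by blast
  ultimately have "fst y = Some m" using R'(2) by simp
  then show ?thesis using False m by simp
qed

lemma minimum_protocol_correct:
  assumes "finite A" "N \<ge> 1" "inj_on x A" "y \<in> set_pmf (minimum_protocol N x A)"
  shows "if A = {} then y = (None, 0)
    else \<exists>m\<in>A. fst y = Some m \<and> (\<forall>j\<in>A. x m \<le> x j)"
proof -
  have "inj_on (\<lambda>i. - int (x i)) A" using assms(3) by (auto simp: inj_on_def)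
  from maximum_protocol_correct[OF assms(1,2) this assms(4)[unfolded minimum_protocol_def]]
  show ?thesis by (cases "A = {}") simp_all
qed

text \<open>Rounds are numbered from \<open>0\<close>, hence \<open>Suc L\<close>. A free
  \<open>L\<close> lets one bound serve all three protocol parameters.\<close>

lemma expected_cost_maximum_protocol:
  assumes "finite A" "card A \<le> N" "inj_on x A" "nat \<lceil>log 2 (real N)\<rceil> \<le> L"
  shows "(\<integral>\<^sup>+y. of_nat (snd y) \<partial>maximum_protocol N x A) \<le> of_nat (3 * Suc L)"
proof (cases "A = {}")
  case False
  have "(\<integral>\<^sup>+y. of_nat (snd y) \<partial>maximum_protocol N x A)
      = (\<integral>\<^sup>+y. of_nat (snd y) \<partial>protocol_rounds N x A (Suc (nat \<lceil>log 2 (real N)\<rceil>)))"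
    using False by (simp add: maximum_protocol_def split_beta' del: protocol_rounds.simps)
  also have "\<dots> \<le> of_nat (3 * Suc (nat \<lceil>log 2 (real N)\<rceil>))"
    using expected_protocol_rounds[OF assms(1-3)] by blast
  also have "\<dots> \<le> of_nat (3 * Suc L)"
    using assms(4) by (intro of_nat_mono) simp
  finally show ?thesis .
qed (simp add: maximum_protocol_def)

lemma expected_cost_minimum_protocol:
  assumes "finite A" "card A \<le> N" "inj_on x A" "nat \<lceil>log 2 (real N)\<rceil> \<le> L"
  shows "(\<integral>\<^sup>+y. of_nat (snd y) \<partial>minimum_protocol N x A) \<le> of_nat (3 * Suc L)"
proof -
  have "inj_on (\<lambda>i. - int (x i)) A" using assms(3) by (auto simp: inj_on_def)
  then show ?thesis
    unfolding minimum_protocol_def using assms by (intro expected_cost_maximum_protocol)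
qed

section \<open>The k largest values\<close>

text \<open>The list inside \<open>kth_largest\<close>. Positions count from \<open>0\<close>, so
  the two values around the cut are at \<open>k - 1\<close> and \<open>k\<close>.\<close>

definition descending :: "nat \<Rightarrow> (nat \<Rightarrow> nat) \<Rightarrow> nat list" where
  "descending n x = rev (sort (map x [1..<Suc n]))"

lemma kth_largest_eq_nth: "kth_largest n k x = descending n x ! (k - 1)"
  by (simp add: kth_largest_def descending_def)

lemma length_descending [simp]: "length (descending n x) = n"
  by (simp add: descending_def)

lemma set_descending: "set (descending n x) = x ` {1..n}"
  by (auto simp: descending_def simp flip: atLeastLessThanSuc_atLeastAtMost)

lemma
  assumes "inj_on x {1..n}"
  shows distinct_descending: "distinct (descending n x)"
    and descending_less: "\<And>i j. i < j \<Longrightarrow> j < n \<Longrightarrow> descending n x ! j < descending n x ! i"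
proof -
  show d: "distinct (descending n x)"
    using assms by (simp add: descending_def distinct_map atLeastLessThanSuc_atLeastAtMost del: upt_Suc)
  then have "sorted_wrt (<) (sort (map x [1..<Suc n]))"
    by (simp add: strict_sorted_iff descending_def del: upt_Suc)
  then have "sorted_wrt (>) (descending n x)"
    by (simp add: descending_def sorted_wrt_rev del: upt_Suc)
  then show "\<And>i j. i < j \<Longrightarrow> j < n \<Longrightarrow> descending n x ! j < descending n x ! i"
    by (simp add: sorted_wrt_iff_nth_less)
qed

lemma descending_le:
  assumes "inj_on x {1..n}" "i \<le> j" "j < n"
  shows "descending n x ! j \<le> descending n x ! i"
  using descending_less[OF assms(1), of i j] assms(2,3) by (cases "i = j") auto

lemma top_k_subset: "top_k n k x \<subseteq> {1..n}"
  by (auto simp: top_k_def)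

text \<open>Strict descent makes the entries that reach position \<open>k - 1\<close> exactly those
  at positions below \<open>k\<close>.\<close>

lemma top_k_image:
  assumes "inj_on x {1..n}" "1 \<le> k" "k \<le> n"
  shows "x ` top_k n k x = set (take k (descending n x))"
proof -
  have "x ` top_k n k x = {d \<in> set (descending n x). descending n x ! (k - 1) \<le> d}"
    by (auto simp: top_k_def set_descending kth_largest_eq_nth)
  also have "\<dots> = {descending n x ! q | q. q < k}"
  proof (intro equalityI subsetI)
    fix d assume "d \<in> {d \<in> set (descending n x). descending n x ! (k - 1) \<le> d}"
    then obtain q where q: "q < n" "d = descending n x ! q" "descending n x ! (k - 1) \<le> d"
      by (auto simp: in_set_conv_nth)
    have "q < k"
    proof (rule ccontr)
      assume "\<not> q < k"
      then have "d < descending n x ! (k - 1)"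
        using descending_less[OF assms(1), of "k - 1" q] assms(2) q(1,2) by auto
      then show False using q(3) by simp
    qed
    then show "d \<in> {descending n x ! q | q. q < k}" using q(2) by blast
  next
    fix d assume "d \<in> {descending n x ! q | q. q < k}"
    then obtain q where "q < k" "d = descending n x ! q" by blast
    then show "d \<in> {d \<in> set (descending n x). descending n x ! (k - 1) \<le> d}"
      using descending_le[OF assms(1), of q "k - 1"] assms(3) by auto
  qed
  also have "\<dots> = set (take k (descending n x))"
    using nth_image[of k "descending n x"] assms(3) by (simp add: image_def Bex_def conj_commute)
  finally show ?thesis .
qed

lemma card_top_k:
  assumes "inj_on x {1..n}" "1 \<le> k" "k \<le> n"
  shows "card (top_k n k x) = k"
proof -
  have "card (top_k n k x) = card (x ` top_k n k x)"
    using inj_on_subset[OF assms(1) top_k_subset] by (simp add: card_image)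
  also have "\<dots> = k"
    using distinct_descending[OF assms(1)] assms(3)
    by (simp add: top_k_image[OF assms] distinct_card distinct_take)
  finally show ?thesis .
qed

lemma top_k_less:
  assumes "i \<in> top_k n k x" "j \<in> {1..n} - top_k n k x"
  shows "x j < x i"
proof -
  have "kth_largest n k x \<le> x i" using assms(1) unfolding top_k_def by blast
  moreover have "\<not> kth_largest n k x \<le> x j" using assms(2) unfolding top_k_def by blast
  ultimately show ?thesis by simp
qed

text \<open>If some \<open>i\<close> in \<open>S\<close> were missing from the top-k set, equal
  cardinalities would give a \<open>j\<close> in the top-k set outside \<open>S\<close>, and
  \<open>x i\<close> and \<open>x j\<close> would each be below the other.\<close>

lemma top_kI:
  assumes "inj_on x {1..n}" "1 \<le> k" "k \<le> n" "S \<subseteq> {1..n}" "card S = k"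
    and "\<And>i j. i \<in> S \<Longrightarrow> j \<in> {1..n} - S \<Longrightarrow> x j < x i"
  shows "top_k n k x = S"
proof -
  have fin: "finite S" "finite (top_k n k x)"
    using finite_subset[OF assms(4)] finite_subset[OF top_k_subset] by simp_all
  have "S \<subseteq> top_k n k x"
  proof
    fix i assume i: "i \<in> S"
    show "i \<in> top_k n k x"
    proof (rule ccontr)
      assume ni: "i \<notin> top_k n k x"
      have "top_k n k x = S" if "top_k n k x \<subseteq> S"
        using card_subset_eq[OF fin(1) that] card_top_k[OF assms(1-3)] assms(5) by simp
      then obtain j where j: "j \<in> top_k n k x" "j \<notin> S" using i ni by blast
      have "x j < x i" using assms(6)[OF i] j subsetD[OF top_k_subset j(1)] by simp
      moreover have "x i < x j" using top_k_less[OF j(1)] i ni assms(4) by blast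
      ultimately show False by simp
    qed
  qed
  from card_subset_eq[OF fin(2) this] show ?thesis
    using card_top_k[OF assms(1-3)] assms(5) by simp
qed

lemma kth_largest_in_image:
  assumes "1 \<le> k" "k \<le> n"
  shows "kth_largest n k x \<in> x ` {1..n}"
proof -
  have "k - 1 < length (descending n x)" using assms by simp
  from nth_mem[OF this] show ?thesis unfolding set_descending kth_largest_eq_nth .
qed

lemma kth_largest_attained:
  assumes "1 \<le> k" "k \<le> n"
  shows "\<exists>i\<in>top_k n k x. x i = kth_largest n k x"
proof -
  obtain i where i: "i \<in> {1..n}" "kth_largest n k x = x i"
    using kth_largest_in_image[OF assms] by (rule imageE)
  from i have "i \<in> top_k n k x" by (simp only: top_k_def mem_Collect_eq order_refl simp_thms)
  with i(2)[symmetric] show ?thesis by (rule bexI)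
qed

lemma le_kth_largest_Suc:
  assumes "inj_on x {1..n}" "1 \<le> k" "k < n" "j \<in> {1..n} - top_k n k x"
  shows "x j \<le> kth_largest n (Suc k) x"
proof -
  have "x j \<in> set (descending n x)" using assms(4) by (simp add: set_descending)
  then obtain q where q: "q < n" "x j = descending n x ! q" by (auto simp: in_set_conv_nth)
  have "x j < descending n x ! (k - 1)"
    using assms(4) unfolding top_k_def kth_largest_eq_nth by (intro not_le_imp_less) blast
  then have "k \<le> q"
    using descending_le[OF assms(1), of q "k - 1"] assms(2,3) q(2) by linarith
  then show ?thesis
    using descending_le[OF assms(1), of k q] q by (simp add: kth_largest_eq_nth)
qed

lemma kth_largest_Suc_less:
  assumes "inj_on x {1..n}" "1 \<le> k" "k < n"
  shows "kth_largest n (Suc k) x < kth_largest n k x"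
  using descending_less[OF assms(1), of "k - 1" k] assms(2,3) by (simp add: kth_largest_eq_nth)

lemma kth_largest_Suc_attained:
  assumes "inj_on x {1..n}" "1 \<le> k" "k < n"
  shows "\<exists>j\<in>{1..n} - top_k n k x. x j = kth_largest n (Suc k) x"
proof -
  obtain j where j: "j \<in> {1..n}" "kth_largest n (Suc k) x = x j"
    using kth_largest_in_image[of "Suc k" n x] assms(3) by auto
  have "x j < kth_largest n k x" using kth_largest_Suc_less[OF assms] unfolding j(2) .
  then have "j \<in> {1..n} - top_k n k x" using j(1) by (simp add: top_k_def)
  with j(2)[symmetric] show ?thesis by (rule bexI)
qed

section \<open>Filter reset\<close>

text \<open>Each run returns an exact maximum, so the IDs found are determined: the nodes left after
  \<open>j\<close> runs carry the values \<open>drop j\<close>, whose maximum is its head.\<close>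

lemma find_largest_correct:
  assumes "inj_on x {1..n}" "n \<le> N" "j \<le> n" "y \<in> set_pmf (find_largest n N x j)"
  shows "map x (fst y) = take j (descending n x) \<and> set (fst y) \<subseteq> {1..n}"
  using assms(3,4)
proof (induction j arbitrary: y)
  case (Suc j)
  obtain ids c m c' where ids: "(ids, c) \<in> set_pmf (find_largest n N x j)"
    and m: "(m, c') \<in> set_pmf (maximum_protocol N x ({1..n} - set ids))"
    and y: "fst y = ids @ [the m]"
    using Suc.prems(2) by auto
  let ?A = "{1..n} - set ids" and ?D = "descending n x"
  have IH: "map x ids = take j ?D" "set ids \<subseteq> {1..n}"
    using Suc.IH[OF _ ids] Suc.prems(1) by auto
  have "x ` ?A = x ` {1..n} - x ` set ids"
    using assms(1) IH(2) by (intro inj_on_image_set_diff[of x "{1..n}"]) auto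
  also have "x ` set ids = set (take j ?D)" using IH(1) by (metis set_map)
  also have "x ` {1..n} = set (take j ?D) \<union> set (drop j ?D)"
    unfolding set_descending[symmetric] set_append[symmetric] append_take_drop_id by (rule refl)
  finally have A: "x ` ?A = set (drop j ?D)"
    using set_take_disj_set_drop_if_distinct[OF distinct_descending[OF assms(1)], of j j] by auto
  have "set (drop j ?D) \<noteq> {}" using Suc.prems(1) by simp
  then have "?A \<noteq> {}" unfolding A[symmetric] by blast
  moreover have "inj_on x ?A" using assms(1) by (rule inj_on_subset) auto
  ultimately have "\<exists>i\<in>?A. m = Some i \<and> (\<forall>j\<in>?A. x j \<le> x i)"
    using maximum_protocol_correct[OF _ _ _ m] assms(2) Suc.prems(1) by simp
  then obtain i where i: "i \<in> ?A" "m = Some i" "\<And>j. j \<in> ?A \<Longrightarrow> x j \<le> x i" by blast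
  have "x i \<in> set (drop j ?D)" using i(1) A by blast
  then obtain q where "q < n - j" "x i = ?D ! (j + q)"
    by (auto simp: in_set_conv_nth)
  then have "x i \<le> ?D ! j" using descending_le[OF assms(1), of j "j + q"] by simp
  moreover have "?D ! j \<in> set (drop j ?D)"
    using Suc.prems(1) by (auto simp: in_set_conv_nth intro!: exI[of _ 0])
  then have "?D ! j \<le> x i" using i(3) A by (metis imageE)
  ultimately have "x i = ?D ! j" by simp
  then show ?case
    using y i(1,2) IH Suc.prems(1) by (simp add: take_Suc_conv_app_nth)
qed simp

lemma filter_reset_correct:
  assumes "inj_on x {1..n}" "1 \<le> k" "k < n" "n \<le> N" "s \<in> set_pmf (filter_reset n k N x c0)"
  shows "top_set s = top_k n k x \<and> T_plus s = kth_largest n k x \<and>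
    T_minus s = kth_largest n (Suc k) x \<and> mid s = (T_plus s + T_minus s) div 2"
proof -
  obtain ids c where ids: "(ids, c) \<in> set_pmf (find_largest n N x (k + 1))"
    and s: "top_set s = set (take k ids)" "T_plus s = x (ids ! (k - 1))" "T_minus s = x (ids ! k)"
      "mid s = (x (ids ! (k - 1)) + x (ids ! k)) div 2"
    using assms(5) by (auto simp: filter_reset_def simp del: find_largest.simps)
  have x: "map x ids = take (Suc k) (descending n x)" "set ids \<subseteq> {1..n}"
    using find_largest_correct[OF assms(1,4) _ ids] assms(3) by auto
  have len: "length ids = Suc k"
    using arg_cong[OF x(1), of length] assms(3) by simp
  have nth: "x (ids ! i) = descending n x ! i" if "i < Suc k" for i
    using arg_cong[OF x(1), of "\<lambda>l. l ! i"] that len by simp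
  have "x ` set (take k ids) = set (take k (descending n x))"
    using arg_cong[OF x(1), of "\<lambda>l. set (take k l)"] by (simp add: take_map min_def)
  also have "\<dots> = x ` top_k n k x" using top_k_image[OF assms(1,2)] assms(3) by simp
  \<comment> \<open>Equality is known only for the values; injectivity of \<open>x\<close> carries
    it back to the IDs.\<close>
  finally have "set (take k ids) = top_k n k x"
    using inj_on_image_eq_iff[OF assms(1) subset_trans[OF set_take_subset x(2)] top_k_subset]
    by blast
  then show ?thesis
    using s nth[of "k - 1"] nth[of k] assms(2) by (simp add: kth_largest_eq_nth)
qed

lemma expected_cost_find_largest:
  assumes "inj_on x {1..n}" "n \<le> N" "nat \<lceil>log 2 (real N)\<rceil> \<le> L"
  shows "(\<integral>\<^sup>+y. of_nat (snd y) \<partial>find_largest n N x j) \<le> of_nat (j * (3 * Suc L))"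
proof (induction j)
  case (Suc j)
  have "(\<integral>\<^sup>+y. of_nat (snd y) \<partial>find_largest n N x (Suc j))
      \<le> of_nat (j * (3 * Suc L)) + of_nat (3 * Suc L)"
    unfolding find_largest.simps
  proof (rule nn_integral_bind_pmf_le[OF _ Suc])
    fix z :: "nat list \<times> nat"
    have "inj_on x ({1..n} - set (fst z))" using assms(1) by (rule inj_on_subset) auto
    moreover have "card ({1..n} - set (fst z)) \<le> N"
      using card_mono[of "{1..n}" "{1..n} - set (fst z)"] assms(2) by simp
    ultimately have "(\<integral>\<^sup>+y. of_nat (snd y) \<partial>maximum_protocol N x ({1..n} - set (fst z)))
        \<le> of_nat (3 * Suc L)"
      using assms(3) by (intro expected_cost_maximum_protocol) auto
    then show "(\<integral>\<^sup>+y. of_nat (snd y) \<partial>measure_pmf (case z of (is, c) \<Rightarrow>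
        maximum_protocol N x ({1..n} - set is) \<bind> (\<lambda>(m, c'). return_pmf (is @ [the m], c + c'))))
        \<le> of_nat (snd z) + of_nat (3 * Suc L)"
      by (simp add: split_beta' nn_integral_add del: mult_Suc_right)
  qed
  then show ?case by (simp add: algebra_simps)
qed simp

text \<open>\<open>Suc k\<close> protocol runs of at most \<open>3 * Suc L\<close> expected messages
  each, and one broadcast of the midpoint.\<close>

lemma expected_cost_filter_reset:
  assumes "inj_on x {1..n}" "n \<le> N" "nat \<lceil>log 2 (real N)\<rceil> \<le> L"
  shows "(\<integral>\<^sup>+s. of_nat (cost s) \<partial>filter_reset n k N x c0)
    \<le> of_nat c0 + of_nat (Suc k * (3 * Suc L) + 1)"
proof -
  have "(\<integral>\<^sup>+s. of_nat (cost s) \<partial>filter_reset n k N x c0)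
      = of_nat c0 + (\<integral>\<^sup>+y. of_nat (snd y) \<partial>find_largest n N x (Suc k)) + 1"
    by (simp add: filter_reset_def split_beta' nn_integral_add del: find_largest.simps)
  also have "\<dots> \<le> of_nat c0 + of_nat (Suc k * (3 * Suc L)) + 1"
    by (intro add_mono expected_cost_find_largest[OF assms] order_refl)
  finally show ?thesis by (simp only: of_nat_add of_nat_1 add.assoc)
qed

section \<open>Offline algorithms\<close>

text \<open>The window is open at \<open>t0\<close> because \<open>F t0\<close> is already the
  assignment after the communication at \<open>t0\<close>.\<close>

lemma offline_run_no_messages:
  assumes "offline_run n k v T F ms" "t0 \<le> t" "t \<le> t1" "t1 \<le> T"
    and "(\<Sum>u\<in>{t0<..t1}. length (ms u)) = 0" "i \<in> {1..n}"
  shows "F t i = F t0 i"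
  using assms(2,3)
proof (induction t rule: dec_induct)
  case (step t)
  have "ms (Suc t) = []" using assms(5) step by simp
  then have "F (Suc t) i = F t i"
    using assms(1,4,6) step.prems unfolding offline_run_def
    by (auto dest!: spec[where x = "Suc t"])
  then show ?case using step by simp
qed simp

text \<open>If \<open>y i < z j\<close>, let the nodes with value at least \<open>z j\<close> in \<open>y\<close>, as well as \<open>j\<close>, take
  their values from \<open>z\<close>. The former belong to the top-k nodes, so they all exceed \<open>z j\<close> in \<open>z\<close> as
  well; hence the result is injective, respects the filters, and ranks \<open>j\<close> above \<open>i\<close>.\<close>

lemma filters_separate:
  assumes F: "set_of_filters n k x F"
    and y: "inj_on y {1..n}" "\<And>i. i \<in> {1..n} \<Longrightarrow> in_filter (y i) (F i)"
    and z: "inj_on z {1..n}" "\<And>i. i \<in> {1..n} \<Longrightarrow> in_filter (z i) (F i)"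
    and i: "i \<in> top_k n k x" and j: "j \<in> {1..n} - top_k n k x"
  shows "z j \<le> y i"
proof (rule ccontr)
  assume "\<not> z j \<le> y i"
  then have less: "y i < z j" by simp
  have top: "top_k n k w = top_k n k x"
    if "inj_on w {1..n}" "\<And>i. i \<in> {1..n} \<Longrightarrow> in_filter (w i) (F i)" for w
    using F that by (simp add: set_of_filters_def)
  define U where "U = insert j {p \<in> {1..n}. z j \<le> y p}"
  define w where "w p = (if p \<in> U then z p else y p)" for p
  have "i \<notin> U" using less i j by (auto simp: U_def)
  have U: "z j \<le> z p" if "p \<in> U" for p
  proof (cases "p = j")
    case False
    then have p: "p \<in> {1..n}" "z j \<le> y p" using that by (auto simp: U_def)
    \<comment> \<open>As \<open>y\<close> respects the filters, \<open>i\<close> is a top-k node for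
      \<open>y\<close> too; a \<open>p\<close> outside would satisfy
      \<open>y p < y i < z j\<close>.\<close>
    have "p \<in> top_k n k x"
    proof (rule ccontr)
      assume "p \<notin> top_k n k x"
      then have "y p < y i" using top_k_less[of i n k y p] top[OF y] i p(1) by simp
      then show False using less p(2) by simp
    qed
    then show ?thesis using top_k_less[of p n k z j] top[OF z] j by simp
  qed simp
  have not_U: "y p < z j" if "p \<in> {1..n} - U" for p
    using that by (auto simp: U_def not_le)
  have "inj_on w {1..n}"
  proof (rule inj_onI)
    fix p q assume pq: "p \<in> {1..n}" "q \<in> {1..n}" "w p = w q"
    show "p = q"
    proof (cases "p \<in> U")
      case True
      then have "q \<in> U" using U[of p] not_U[of q] pq(2,3) by (cases "q \<in> U") (simp_all add: w_def)
      then show ?thesis using True pq inj_onD[OF z(1), of p q] by (simp add: w_def)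
    next
      case False
      then have "q \<notin> U" using U[of q] not_U[of p] pq(1,3) by (cases "q \<in> U") (simp_all add: w_def)
      then show ?thesis using False pq inj_onD[OF y(1), of p q] by (simp add: w_def)
    qed
  qed
  moreover have "in_filter (w p) (F p)" if "p \<in> {1..n}" for p
    using that y(2) z(2) by (simp add: w_def)
  ultimately have "top_k n k w = top_k n k x" by (rule top)
  then have "w j < w i" using top_k_less[of i n k w j] i j by simp
  then show False using less \<open>i \<notin> U\<close> by (simp add: w_def U_def)
qed

text \<open>Without a message at time \<open>0\<close> all filters are trivial and admit every
  tuple, including one with another top-k set. This message pays for the initial reset.\<close>

lemma offline_run_initial_message:
  assumes "monitoring_instance n k v T" "offline_run n k v T F ms"
  shows "1 \<le> length (ms 0)"
proof (rule ccontr)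
  assume "\<not> 1 \<le> length (ms 0)"
  then have "ms 0 = []" by (simp add: not_le)
  then have F: "F 0 i = (Minf, Pinf)" if "i \<in> {1..n}" for i
    using assms(2) that by (auto simp: offline_run_def)
  have k: "1 \<le> k" "k < n" and inj: "inj_on (v 0) {1..n}"
    using assms(1) by (auto simp: monitoring_instance_def)
  have sof: "set_of_filters n k (v 0) (F 0)" using assms(2) by (simp add: offline_run_def)
  have infi: "in_filter a (F 0 i)" if "i \<in> {1..n}" for a i
    using F[OF that] by (simp add: in_filter_def)
  obtain i where i: "i \<in> top_k n k (v 0)" "v 0 i = kth_largest n k (v 0)"
    using kth_largest_attained[OF k(1) less_imp_le[OF k(2)]] by blast
  obtain j where j: "j \<in> {1..n} - top_k n k (v 0)" "v 0 j = kth_largest n (Suc k) (v 0)"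
    using kth_largest_Suc_attained[OF inj k] by blast
  have ij: "i \<in> {1..n}" "j \<in> {1..n}" using subsetD[OF top_k_subset i(1)] j(1) by simp_all
  \<comment> \<open>Swapping the values of a top-k node and another node keeps injectivity but
    changes the top-k set.\<close>
  define z where "z = v 0 \<circ> Transposition.transpose i j"
  have "inj_on z {1..n}"
    unfolding z_def
  proof (rule comp_inj_on)
    have "Transposition.transpose i j ` {1..n} = {1..n}" using ij by (simp only: transpose_image_eq)
    then show "inj_on (v 0) (Transposition.transpose i j ` {1..n})" using inj by simp
  qed (rule inj_on_subset[OF inj_transpose subset_UNIV])
  have "top_k n k z = top_k n k (v 0)"
    using sof \<open>inj_on z {1..n}\<close> infi by (simp add: set_of_filters_def)
  then have "z j < z i" using top_k_less[of i n k z j] i(1) j(1) by simp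
  moreover have "v 0 j < v 0 i" using top_k_less[OF i(1) j(1)] .
  moreover have "i \<noteq> j" using i(1) j(1) by blast
  ultimately show False by (simp add: z_def)
qed

text \<open>One-point filters, broadcast anew at each time, always work. Hence the infimum in
  \<open>opt_messages\<close> is over a nonempty set and is attained.\<close>

lemma offline_run_exists:
  assumes "monitoring_instance n k v T"
  shows "\<exists>F ms. offline_run n k v T F ms"
proof -
  have "set_of_filters n k (v t) (\<lambda>i. (Fin (v t i), Fin (v t i)))" for t
  proof -
    have eq: "in_filter a (Fin b, Fin b) \<longleftrightarrow> a = b" for a b
      by (auto simp: in_filter_def)
    show ?thesis
      unfolding set_of_filters_def eq
    proof (intro conjI allI impI)
      fix y assume "inj_on y {1..n} \<and> (\<forall>i\<in>{1..n}. y i = v t i)"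
      then have y: "\<forall>i\<in>{1..n}. y i = v t i" by blast
      then have "map y [1..<Suc n] = map (v t) [1..<Suc n]" by (intro map_cong) auto
      then have "kth_largest n k y = kth_largest n k (v t)" by (simp only: kth_largest_def)
      then show "top_k n k y = top_k n k (v t)" using y by (auto simp: top_k_def)
    qed simp
  qed
  then have "offline_run n k v T (\<lambda>t i. (Fin (v t i), Fin (v t i))) (\<lambda>t. [Broadcast])"
    by (simp add: offline_run_def)
  then show ?thesis by blast
qed

section \<open>One step of the monitoring algorithm\<close>

text \<open>Filters on the two sides share the end point \<open>M\<close>, so they give only a weak
  inequality between the sides; injectivity makes it strict and \<open>top_kI\<close>
  applies.\<close>

lemma set_of_filters_threshold:
  assumes "S \<subseteq> {1..n}" "card S = k" "1 \<le> k" "k \<le> n" "inj_on x {1..n}"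
    and "\<And>i. i \<in> S \<Longrightarrow> M \<le> x i" "\<And>j. j \<in> {1..n} - S \<Longrightarrow> x j \<le> M"
  shows "top_k n k x = S"
    and "set_of_filters n k x (\<lambda>i. if i \<in> S then (Fin M, Pinf) else (Minf, Fin M))"
proof -
  have top: "top_k n k y = S"
    if y: "inj_on y {1..n}" "\<And>i. i \<in> S \<Longrightarrow> M \<le> y i" "\<And>j. j \<in> {1..n} - S \<Longrightarrow> y j \<le> M" for y
  proof (rule top_kI[OF y(1) assms(3,4,1,2)])
    fix i j assume ij: "i \<in> S" "j \<in> {1..n} - S"
    then have "y j \<noteq> y i" using inj_onD[OF y(1), of j i] subsetD[OF assms(1)] by auto
    moreover have "y j \<le> y i" using y(2)[OF ij(1)] y(3)[OF ij(2)] by simp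
    ultimately show "y j < y i" by simp
  qed
  show x: "top_k n k x = S" using assms(5-7) by (rule top)
  show "set_of_filters n k x (\<lambda>i. if i \<in> S then (Fin M, Pinf) else (Minf, Fin M))"
    unfolding set_of_filters_def x
  proof (intro conjI ballI allI impI)
    fix i assume "i \<in> {1..n}"
    then show "in_filter (x i) (if i \<in> S then (Fin M, Pinf) else (Minf, Fin M))"
      using assms(6,7) by (auto simp: in_filter_def)
  next
    fix y assume y: "inj_on y {1..n} \<and> (\<forall>i\<in>{1..n}.
        in_filter (y i) (if i \<in> S then (Fin M, Pinf) else (Minf, Fin M)))"
    show "top_k n k y = S"
    proof (rule top)
      show "M \<le> y i" if "i \<in> S" for i
        using bspec[OF conjunct2[OF y], of i] that subsetD[OF assms(1) that]
        by (simp add: in_filter_def)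
      show "y j \<le> M" if "j \<in> {1..n} - S" for j
        using bspec[OF conjunct2[OF y], of j] that by (simp add: in_filter_def)
    qed (use y in blast)
  qed
qed

text \<open>The update with the minimum over the whole set \<open>S\<close>, although the algorithm
  may have queried only the violating nodes: this form does not mention the random run.\<close>

definition next_T_plus :: "(nat \<Rightarrow> nat) \<Rightarrow> nat set \<Rightarrow> nat \<Rightarrow> nat" where
  "next_T_plus x S tp = min tp (Min (x ` S))"

definition next_T_minus :: "nat \<Rightarrow> (nat \<Rightarrow> nat) \<Rightarrow> nat set \<Rightarrow> nat \<Rightarrow> nat" where
  "next_T_minus n x S tm = max tm (Max (x ` ({1..n} - S)))"

text \<open>The end of \<open>monitor_step\<close> with the true extrema in place of the protocol
  results; the messages \<open>c\<close> sent so far are the only link to the preceding random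
  phases.\<close>

definition communicate :: "nat \<Rightarrow> nat \<Rightarrow> nat \<Rightarrow> (nat \<Rightarrow> nat) \<Rightarrow> monitor_state \<Rightarrow> nat \<Rightarrow> monitor_state pmf" where
  "communicate n k N x s c =
    (let tp = next_T_plus x (top_set s) (T_plus s); tm = next_T_minus n x (top_set s) (T_minus s)
     in if tp < tm then filter_reset n k N x c
        else return_pmf \<lparr> top_set = top_set s, T_plus = tp, T_minus = tm,
          mid = (tm + tp) div 2, cost = c + 1 \<rparr>)"

definition complete_extrema ::
  "nat \<Rightarrow> nat \<Rightarrow> nat \<Rightarrow> (nat \<Rightarrow> nat) \<Rightarrow> nat set \<Rightarrow> nat option \<Rightarrow> nat option \<Rightarrow>
    (nat option \<times> nat option \<times> nat) pmf" where
  "complete_extrema n N_top N_rest x S mn mx =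
    (if mx = None then map_pmf (\<lambda>(m, c). (mn, m, c)) (maximum_protocol N_rest x ({1..n} - S))
     else map_pmf (\<lambda>(m, c). (m, mx, c)) (minimum_protocol N_top x S))"

lemma monitor_step_violating:
  "{i \<in> top_set s. \<not> in_filter (x i) (assigned_filter s i)} = {i \<in> top_set s. x i < mid s}"
  "{i \<in> {1..n} - top_set s. \<not> in_filter (x i) (assigned_filter s i)}
    = {i \<in> {1..n} - top_set s. mid s < x i}"
  by (auto simp: in_filter_def assigned_filter_def)

text \<open>Both protocols run on empty sets and send nothing, so even the cost is
  unchanged.\<close>

lemma monitor_step_quiet:
  assumes "\<And>i. i \<in> top_set s \<Longrightarrow> mid s \<le> x i" "\<And>j. j \<in> {1..n} - top_set s \<Longrightarrow> x j \<le> mid s"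
  shows "monitor_step n k N_top N_rest N_all x s = return_pmf s"
proof -
  have 1: "{i \<in> top_set s. x i < mid s} = {}" using assms(1) by (auto simp: not_less)
  have 2: "{i \<in> {1..n} - top_set s. mid s < x i} = {}" using assms(2) by (auto simp: not_less)
  show ?thesis
    unfolding monitor_step_def Let_def monitor_step_violating 1 2
    by (simp add: minimum_protocol_def maximum_protocol_def bind_return_pmf)
qed

text \<open>A time step with at least one violation; \<open>M\<close> is the midpoint in
  force.\<close>

locale monitor_violation =
  fixes n N_top N_rest :: nat and x :: "nat \<Rightarrow> nat" and S :: "nat set" and M :: nat
  assumes S: "S \<subseteq> {1..n}" "S \<noteq> {}" "{1..n} - S \<noteq> {}"
    and N: "card S \<le> N_top" "card ({1..n} - S) \<le> N_rest"
    and inj: "inj_on x {1..n}"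
    and violation: "(\<exists>i\<in>S. x i < M) \<or> (\<exists>j\<in>{1..n} - S. M < x j)"
begin

lemma finite_S: "finite S"
  using finite_subset[OF S(1)] by simp

lemma N_pos: "1 \<le> N_top" "1 \<le> N_rest"
  using N S(2,3) finite_S card_gt_0_iff[of S] card_gt_0_iff[of "{1..n} - S"] by simp_all

text \<open>Nodes of \<open>S\<close> without a violation have values at least \<open>M\<close>,
  above all violating ones, so the minimum over the violating nodes is already the minimum over
  \<open>S\<close>.\<close>

lemma minimum_violating:
  assumes "y \<in> set_pmf (minimum_protocol N_top x {i \<in> S. x i < M})"
  shows "if \<forall>i\<in>S. M \<le> x i then fst y = None else \<exists>m. fst y = Some m \<and> x m = Min (x ` S)"
proof -
  let ?A = "{i \<in> S. x i < M}"
  have "finite ?A" using finite_S by simp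
  have "inj_on x ?A" by (rule inj_on_subset[OF inj]) (use S(1) in auto)
  note correct = minimum_protocol_correct[OF \<open>finite ?A\<close> N_pos(1) this assms]
  show ?thesis
  proof (cases "?A = {}")
    case True
    then have "\<forall>i\<in>S. M \<le> x i" by (auto simp: not_less)
    then show ?thesis using correct True by simp
  next
    case False
    then obtain m where m: "m \<in> ?A" "fst y = Some m" "\<forall>j\<in>?A. x m \<le> x j"
      using correct by (auto simp: if_not_P)
    have "x m \<le> x j" if "j \<in> S" for j
      using m(1,3) that by (cases "x j < M") auto
    then have "x m = Min (x ` S)"
      using m(1) finite_S by (intro Min_eqI[symmetric]) auto
    moreover have "\<not> (\<forall>i\<in>S. M \<le> x i)" using m(1) by (auto simp: not_le)
    ultimately show ?thesis using m(2) by simp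
  qed
qed

lemma maximum_violating:
  assumes "y \<in> set_pmf (maximum_protocol N_rest x {i \<in> {1..n} - S. M < x i})"
  shows "if \<forall>j\<in>{1..n} - S. x j \<le> M then fst y = None
    else \<exists>m. fst y = Some m \<and> x m = Max (x ` ({1..n} - S))"
proof -
  let ?A = "{i \<in> {1..n} - S. M < x i}"
  have "finite ?A" by simp
  have "inj_on x ?A" by (rule inj_on_subset[OF inj]) auto
  note correct = maximum_protocol_correct[OF \<open>finite ?A\<close> N_pos(2) this assms]
  show ?thesis
  proof (cases "?A = {}")
    case True
    then have "\<forall>j\<in>{1..n} - S. x j \<le> M" by (auto simp: not_less)
    then show ?thesis using correct True by simp
  next
    case False
    then obtain m where m: "m \<in> ?A" "fst y = Some m" "\<forall>j\<in>?A. x j \<le> x m"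
      using correct by (auto simp: if_not_P)
    have "x j \<le> x m" if "j \<in> {1..n} - S" for j
      using m(1,3) that by (cases "M < x j") auto
    then have "x m = Max (x ` ({1..n} - S))"
      using m(1) by (intro Max_eqI[symmetric]) auto
    moreover have "\<not> (\<forall>j\<in>{1..n} - S. x j \<le> M)" using m(1) by (auto simp: not_le)
    ultimately show ?thesis using m(2) by simp
  qed
qed

lemma complete_extrema_correct:
  assumes "if \<forall>i\<in>S. M \<le> x i then mn = None else \<exists>m. mn = Some m \<and> x m = Min (x ` S)"
    and "if \<forall>j\<in>{1..n} - S. x j \<le> M then mx = None
      else \<exists>m. mx = Some m \<and> x m = Max (x ` ({1..n} - S))"
    and "(mn', mx', c) \<in> set_pmf (complete_extrema n N_top N_rest x S mn mx)"
  shows "x (the mn') = Min (x ` S) \<and> x (the mx') = Max (x ` ({1..n} - S))"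
proof (cases "\<forall>j\<in>{1..n} - S. x j \<le> M")
  case True
  then have "mx = None" using assms(2) by simp
  then have mn: "mn' = mn" and mx: "(mx', c) \<in> set_pmf (maximum_protocol N_rest x ({1..n} - S))"
    using assms(3) by (auto simp: complete_extrema_def)
  have "inj_on x ({1..n} - S)" by (rule inj_on_subset[OF inj]) auto
  from maximum_protocol_correct[OF _ N_pos(2) this mx] S(3)
  have "\<exists>m\<in>{1..n} - S. mx' = Some m \<and> (\<forall>j\<in>{1..n} - S. x j \<le> x m)" by simp
  then obtain m where "m \<in> {1..n} - S" "mx' = Some m" "\<forall>j\<in>{1..n} - S. x j \<le> x m" by blast
  then have "x (the mx') = Max (x ` ({1..n} - S))"
    by (intro Max_eqI[symmetric]) auto
  \<comment> \<open>No node outside \<open>S\<close> violates its filter, so some node in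
    \<open>S\<close> does and \<open>mn\<close> already holds the minimum.\<close>
  moreover have top: "\<not> (\<forall>i\<in>S. M \<le> x i)" using violation True by (auto simp: not_le[symmetric])
  obtain l where "mn = Some l" "x l = Min (x ` S)"
    using assms(1) unfolding if_not_P[OF top] by blast
  ultimately show ?thesis using mn by simp
next
  case False
  then obtain m where m: "mx = Some m" "x m = Max (x ` ({1..n} - S))"
    using assms(2) unfolding if_not_P[OF False] by blast
  then have mx: "mx' = Some m" and mn: "(mn', c) \<in> set_pmf (minimum_protocol N_top x S)"
    using assms(3) by (auto simp: complete_extrema_def)
  have "inj_on x S" using inj S(1) by (rule inj_on_subset)
  from minimum_protocol_correct[OF finite_S N_pos(1) this mn] S(2)
  have "\<exists>l\<in>S. mn' = Some l \<and> (\<forall>j\<in>S. x l \<le> x j)" by simp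
  then obtain l where "l \<in> S" "mn' = Some l" "\<forall>j\<in>S. x l \<le> x j" by blast
  then have "x (the mn') = Min (x ` S)"
    using finite_S by (intro Min_eqI[symmetric]) auto
  then show ?thesis using mx m by simp
qed

text \<open>The next state depends on the random results only through the message counts
  \<open>c1\<close>, \<open>c2\<close>, \<open>c3\<close>.\<close>

lemma monitor_step_eq:
  assumes "top_set s = S" "mid s = M"
  shows "monitor_step n k N_top N_rest N_all x s =
    bind_pmf (minimum_protocol N_top x {i \<in> S. x i < M}) (\<lambda>(mn, c1).
    bind_pmf (maximum_protocol N_rest x {i \<in> {1..n} - S. M < x i}) (\<lambda>(mx, c2).
    bind_pmf (complete_extrema n N_top N_rest x S mn mx) (\<lambda>(mn', mx', c3).
      communicate n k N_all x s (cost s + c1 + c2 + c3))))"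
proof -
  let ?f = "\<lambda>mn c1 mx c2. if mn = None \<and> mx = None then return_pmf (s\<lparr>cost := cost s + c1 + c2\<rparr>)
    else bind_pmf (complete_extrema n N_top N_rest x S mn mx) (\<lambda>(mn', mx', c3).
      let tp = min (T_plus s) (x (the mn'));
          tm = max (T_minus s) (x (the mx'));
          c = cost s + c1 + c2 + c3
      in if tp < tm then filter_reset n k N_all x c
         else return_pmf \<lparr> top_set = S, T_plus = tp, T_minus = tm, mid = (tm + tp) div 2, cost = c + 1 \<rparr>)"
  have inner: "?f mn c1 mx c2 = bind_pmf (complete_extrema n N_top N_rest x S mn mx) (\<lambda>(mn', mx', c3).
      communicate n k N_all x s (cost s + c1 + c2 + c3))"
    if mn: "(mn, c1) \<in> set_pmf (minimum_protocol N_top x {i \<in> S. x i < M})"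
      and mx: "(mx, c2) \<in> set_pmf (maximum_protocol N_rest x {i \<in> {1..n} - S. M < x i})"
    for mn c1 mx c2
  proof -
    note mn' = minimum_violating[OF mn, unfolded fst_conv]
      and mx' = maximum_violating[OF mx, unfolded fst_conv]
    \<comment> \<open>The branch without communication is excluded by the violation.\<close>
    have "\<not> (mn = None \<and> mx = None)"
      using mn' mx' violation by (auto simp: not_le[symmetric] split: if_splits)
    then have "?f mn c1 mx c2 = bind_pmf (complete_extrema n N_top N_rest x S mn mx) (\<lambda>(mn', mx', c3).
      let tp = min (T_plus s) (x (the mn'));
          tm = max (T_minus s) (x (the mx'));
          c = cost s + c1 + c2 + c3
      in if tp < tm then filter_reset n k N_all x c
         else return_pmf \<lparr> top_set = S, T_plus = tp, T_minus = tm, mid = (tm + tp) div 2, cost = c + 1 \<rparr>)"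
      by (rule if_not_P)
    also have "\<dots> = bind_pmf (complete_extrema n N_top N_rest x S mn mx) (\<lambda>(mn', mx', c3).
      communicate n k N_all x s (cost s + c1 + c2 + c3))"
    proof (intro bind_pmf_cong refl)
      fix y assume y: "y \<in> set_pmf (complete_extrema n N_top N_rest x S mn mx)"
      obtain a b c where abc: "y = (a, b, c)" by (cases y) auto
      from complete_extrema_correct[OF mn' mx' y[unfolded abc]]
      show "(case y of (mn', mx', c3) \<Rightarrow>
          let tp = min (T_plus s) (x (the mn'));
              tm = max (T_minus s) (x (the mx'));
              c = cost s + c1 + c2 + c3
          in if tp < tm then filter_reset n k N_all x c
             else return_pmf \<lparr> top_set = S, T_plus = tp, T_minus = tm, mid = (tm + tp) div 2, cost = c + 1 \<rparr>)
        = (case y of (mn', mx', c3) \<Rightarrow> communicate n k N_all x s (cost s + c1 + c2 + c3))"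
        by (simp add: abc communicate_def next_T_plus_def next_T_minus_def Let_def assms(1))
    qed
    finally show ?thesis .
  qed
  have "monitor_step n k N_top N_rest N_all x s =
    bind_pmf (minimum_protocol N_top x {i \<in> S. x i < M}) (\<lambda>(mn, c1).
    bind_pmf (maximum_protocol N_rest x {i \<in> {1..n} - S. M < x i}) (\<lambda>(mx, c2). ?f mn c1 mx c2))"
    unfolding monitor_step_def Let_def monitor_step_violating
    unfolding complete_extrema_def assms
    by (rule refl)
  also have "\<dots> = bind_pmf (minimum_protocol N_top x {i \<in> S. x i < M}) (\<lambda>(mn, c1).
    bind_pmf (maximum_protocol N_rest x {i \<in> {1..n} - S. M < x i}) (\<lambda>(mx, c2).
    bind_pmf (complete_extrema n N_top N_rest x S mn mx) (\<lambda>(mn', mx', c3).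
      communicate n k N_all x s (cost s + c1 + c2 + c3))))"
  proof (rule bind_pmf_cong[OF refl])
    fix y assume y: "y \<in> set_pmf (minimum_protocol N_top x {i \<in> S. x i < M})"
    obtain mn c1 where y_eq: "y = (mn, c1)" by (cases y)
    show "(case y of (mn, c1) \<Rightarrow> bind_pmf (maximum_protocol N_rest x {i \<in> {1..n} - S. M < x i})
          (\<lambda>(mx, c2). ?f mn c1 mx c2))
      = (case y of (mn, c1) \<Rightarrow> bind_pmf (maximum_protocol N_rest x {i \<in> {1..n} - S. M < x i})
          (\<lambda>(mx, c2). bind_pmf (complete_extrema n N_top N_rest x S mn mx) (\<lambda>(mn', mx', c3).
            communicate n k N_all x s (cost s + c1 + c2 + c3))))"
      unfolding y_eq prod.case
    proof (rule bind_pmf_cong[OF refl])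
      fix z assume z: "z \<in> set_pmf (maximum_protocol N_rest x {i \<in> {1..n} - S. M < x i})"
      obtain mx c2 where z_eq: "z = (mx, c2)" by (cases z)
      show "(case z of (mx, c2) \<Rightarrow> ?f mn c1 mx c2)
        = (case z of (mx, c2) \<Rightarrow> bind_pmf (complete_extrema n N_top N_rest x S mn mx)
            (\<lambda>(mn', mx', c3). communicate n k N_all x s (cost s + c1 + c2 + c3)))"
        unfolding z_eq prod.case by (rule inner[OF y[unfolded y_eq] z[unfolded z_eq]])
    qed
  qed
  finally show ?thesis .
qed

lemma monitor_step_support:
  assumes "top_set s = S" "mid s = M" "s' \<in> set_pmf (monitor_step n k N_top N_rest N_all x s)"
  shows "\<exists>c. s' \<in> set_pmf (communicate n k N_all x s c)"
  using assms(3) unfolding monitor_step_eq[OF assms(1,2)] by (auto, blast)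

lemma expected_cost_monitor_step:
  assumes "top_set s = S" "mid s = M" "n \<le> N_all"
    and L: "nat \<lceil>log 2 (real N_top)\<rceil> \<le> L" "nat \<lceil>log 2 (real N_rest)\<rceil> \<le> L"
      "nat \<lceil>log 2 (real N_all)\<rceil> \<le> L"
  shows "(\<integral>\<^sup>+s'. of_nat (cost s') \<partial>monitor_step n k N_top N_rest N_all x s)
    \<le> of_nat (cost s) + of_nat (3 * (3 * Suc L) + 1 +
      (if next_T_plus x S (T_plus s) < next_T_minus n x S (T_minus s) then Suc k * (3 * Suc L) + 1 else 0))"
proof -
  let ?P = "3 * Suc L"
  \<comment> \<open>The leading \<open>1\<close> is the midpoint broadcast. It is also counted when
    a reset occurs, so that every violation costs at most \<open>3 * ?P + 1\<close> apart from the
    reset itself.\<close>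
  define K where "K = 1 + (if next_T_plus x S (T_plus s) < next_T_minus n x S (T_minus s)
    then Suc k * ?P + 1 else 0)"
  have K: "(\<integral>\<^sup>+s'. of_nat (cost s') \<partial>communicate n k N_all x s c) \<le> of_nat c + of_nat K" for c
  proof (cases "next_T_plus x S (T_plus s) < next_T_minus n x S (T_minus s)")
    case True
    have "(\<integral>\<^sup>+s'. of_nat (cost s') \<partial>filter_reset n k N_all x c) \<le> of_nat c + of_nat (Suc k * ?P + 1)"
      by (rule expected_cost_filter_reset[OF inj assms(3) L(3)])
    also have "\<dots> \<le> of_nat c + of_nat K"
      using True by (intro add_left_mono of_nat_mono) (simp add: K_def)
    finally show ?thesis using True by (simp add: communicate_def Let_def assms(1))
  next
    case False
    then show ?thesis by (simp add: communicate_def Let_def assms(1) K_def)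
  qed
  have inj_sub: "inj_on x A" if "A \<subseteq> {1..n}" for A using inj that by (rule inj_on_subset)
  have min_cost: "(\<integral>\<^sup>+y. of_nat (snd y) \<partial>minimum_protocol N_top x A) \<le> of_nat ?P" if "A \<subseteq> S" for A
    using card_mono[OF finite_S that] N(1) finite_subset[OF that finite_S] inj_sub[of A] S(1) that L(1)
    by (intro expected_cost_minimum_protocol) auto
  have max_cost: "(\<integral>\<^sup>+y. of_nat (snd y) \<partial>maximum_protocol N_rest x A) \<le> of_nat ?P"
    if "A \<subseteq> {1..n} - S" for A
    using card_mono[OF _ that] N(2) finite_subset[OF that] inj_sub[of A] that L(2)
    by (intro expected_cost_maximum_protocol) auto
  have extrema_cost: "(\<integral>\<^sup>+y. of_nat (snd (snd y)) \<partial>complete_extrema n N_top N_rest x S mn mx) \<le> of_nat ?P"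
    for mn mx
    using min_cost[of S] max_cost[of "{1..n} - S"]
    by (simp add: complete_extrema_def split_beta' del: mult_Suc_right)
  have third: "(\<integral>\<^sup>+s'. of_nat (cost s') \<partial>measure_pmf (bind_pmf (complete_extrema n N_top N_rest x S mn mx)
      (\<lambda>(mn', mx', c3). communicate n k N_all x s (cost s + c1 + c2 + c3))))
      \<le> of_nat ?P + of_nat (cost s + c1 + c2 + K)" for mn mx c1 c2
  proof (rule nn_integral_bind_pmf_le[OF _ extrema_cost])
    fix y :: "nat option \<times> nat option \<times> nat"
    show "(\<integral>\<^sup>+s'. of_nat (cost s') \<partial>measure_pmf (case y of (mn', mx', c3) \<Rightarrow>
        communicate n k N_all x s (cost s + c1 + c2 + c3)))
        \<le> of_nat (snd (snd y)) + of_nat (cost s + c1 + c2 + K)"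
      using K[of "cost s + c1 + c2 + snd (snd y)"] by (simp add: split_beta' ac_simps)
  qed
  have second: "(\<integral>\<^sup>+s'. of_nat (cost s') \<partial>measure_pmf
      (bind_pmf (maximum_protocol N_rest x {i \<in> {1..n} - S. M < x i}) (\<lambda>(mx, c2).
      bind_pmf (complete_extrema n N_top N_rest x S mn mx)
      (\<lambda>(mn', mx', c3). communicate n k N_all x s (cost s + c1 + c2 + c3)))))
      \<le> of_nat ?P + of_nat (cost s + c1 + ?P + K)" for mn c1
  proof (rule nn_integral_bind_pmf_le[OF _ max_cost])
    fix y :: "nat option \<times> nat"
    show "(\<integral>\<^sup>+s'. of_nat (cost s') \<partial>measure_pmf (case y of (mx, c2) \<Rightarrow>
        bind_pmf (complete_extrema n N_top N_rest x S mn mx)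
        (\<lambda>(mn', mx', c3). communicate n k N_all x s (cost s + c1 + c2 + c3))))
        \<le> of_nat (snd y) + of_nat (cost s + c1 + ?P + K)"
      using third[of mn "fst y" c1 "snd y"] by (simp add: split_beta' ac_simps del: mult_Suc_right)
  qed auto
  have "(\<integral>\<^sup>+s'. of_nat (cost s') \<partial>monitor_step n k N_top N_rest N_all x s)
      \<le> of_nat ?P + of_nat (cost s + ?P + ?P + K)"
    unfolding monitor_step_eq[OF assms(1,2)]
  proof (rule nn_integral_bind_pmf_le[OF _ min_cost])
    fix y :: "nat option \<times> nat"
    show "(\<integral>\<^sup>+s'. of_nat (cost s') \<partial>measure_pmf (case y of (mn, c1) \<Rightarrow>
        bind_pmf (maximum_protocol N_rest x {i \<in> {1..n} - S. M < x i}) (\<lambda>(mx, c2).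
        bind_pmf (complete_extrema n N_top N_rest x S mn mx)
        (\<lambda>(mn', mx', c3). communicate n k N_all x s (cost s + c1 + c2 + c3)))))
        \<le> of_nat (snd y) + of_nat (cost s + ?P + ?P + K)"
      using second[of "fst y" "snd y"]
      by (cases y) (simp only: prod.case fst_conv snd_conv of_nat_add ac_simps)
  qed auto
  also have "\<dots> = of_nat (cost s) + of_nat (3 * ?P + K)"
    by (simp only: of_nat_add[symmetric]) (simp add: algebra_simps)
  finally show ?thesis by (simp only: K_def add.assoc)
qed

end

section \<open>Competitive analysis\<close>

text \<open>State distribution \<open>p\<close> at time \<open>t\<close>: everything but the cost is deterministic. The last reset
  was at time \<open>t0\<close>; \<open>r\<close> counts the resets and \<open>w\<close> the time steps with a violation. Each violation
  without a reset halves the gap \<open>tp - tm + 1\<close>.\<close>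

definition monitor_inv ::
  "nat \<Rightarrow> nat \<Rightarrow> (nat \<Rightarrow> nat \<Rightarrow> nat) \<Rightarrow> (nat \<Rightarrow> message list) \<Rightarrow> nat \<Rightarrow> real \<Rightarrow> nat \<Rightarrow> monitor_state pmf \<Rightarrow>
    nat set \<Rightarrow> nat \<Rightarrow> nat \<Rightarrow> nat \<Rightarrow> nat \<Rightarrow> nat \<Rightarrow> bool" where
  "monitor_inv n k v ms P D t p S tp tm t0 r w \<longleftrightarrow>
     (\<forall>s\<in>set_pmf p. top_set s = S \<and> T_plus s = tp \<and> T_minus s = tm \<and> mid s = (tp + tm) div 2) \<and>
     t0 \<le> t \<and> (\<forall>u\<in>{t0..t}. top_k n k (v u) = S) \<and> tm \<le> tp \<and>
     (\<forall>i\<in>S. (tp + tm) div 2 \<le> v t i) \<and> (\<forall>j\<in>{1..n} - S. v t j \<le> (tp + tm) div 2) \<and>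
     (\<exists>i\<in>S. \<exists>u\<in>{t0..t}. tp = v u i) \<and> (\<exists>j\<in>{1..n} - S. \<exists>u\<in>{t0..t}. tm = v u j) \<and>
     r \<le> (\<Sum>u\<le>t0. length (ms u)) \<and>
     real w + log 2 (real (tp - tm + 1)) \<le> real r * (D + 2) \<and>
     (\<integral>\<^sup>+s. of_nat (cost s) \<partial>p) \<le> of_nat (r * (Suc k * P + 1) + w * (3 * P + 1))"

section \<open>Resets, charges to the offline algorithm, and the shrinking gap\<close>

lemma max_gap_ge:
  assumes "monitoring_instance n k v T" "t \<le> T"
  shows "1 \<le> kth_largest n k (v t) - kth_largest n (Suc k) (v t)"
    and "kth_largest n k (v t) - kth_largest n (Suc k) (v t) \<le> max_gap n k v T"
proof -
  have "kth_largest n (Suc k) (v t) < kth_largest n k (v t)"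
    using assms by (intro kth_largest_Suc_less) (auto simp: monitoring_instance_def)
  then show "1 \<le> kth_largest n k (v t) - kth_largest n (Suc k) (v t)" by simp
  show "kth_largest n k (v t) - kth_largest n (Suc k) (v t) \<le> max_gap n k v T"
    unfolding max_gap_def using assms(2) by (intro Max_ge imageI) auto
qed

lemma monitor_inv_reset:
  assumes inst: "monitoring_instance n k v T" and "t \<le> T" "n \<le> N"
    and p: "\<And>s. s \<in> set_pmf p \<Longrightarrow> \<exists>c. s \<in> set_pmf (filter_reset n k N (v t) c)"
    and D: "D = log 2 (real (max_gap n k v T))"
    and r: "r \<le> (\<Sum>u\<le>t. length (ms u))" and w: "real w + D + 1 \<le> real r * (D + 2)"
    and cost: "(\<integral>\<^sup>+s. of_nat (cost s) \<partial>p) \<le> of_nat (r * (Suc k * P + 1) + w * (3 * P + 1))"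
  shows "monitor_inv n k v ms P D t p (top_k n k (v t)) (kth_largest n k (v t))
    (kth_largest n (Suc k) (v t)) t r w"
proof -
  let ?S = "top_k n k (v t)" and ?tp = "kth_largest n k (v t)" and ?tm = "kth_largest n (Suc k) (v t)"
  have k: "1 \<le> k" "k < n" and inj: "inj_on (v t) {1..n}"
    using inst \<open>t \<le> T\<close> by (auto simp: monitoring_instance_def)
  have less: "?tm < ?tp" using kth_largest_Suc_less[OF inj k] .
  have "\<forall>s\<in>set_pmf p. top_set s = ?S \<and> T_plus s = ?tp \<and> T_minus s = ?tm \<and> mid s = (?tp + ?tm) div 2"
  proof
    fix s assume "s \<in> set_pmf p"
    then obtain c where "s \<in> set_pmf (filter_reset n k N (v t) c)" using p by blast
    from filter_reset_correct[OF inj k \<open>n \<le> N\<close> this]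
    show "top_set s = ?S \<and> T_plus s = ?tp \<and> T_minus s = ?tm \<and> mid s = (?tp + ?tm) div 2" by simp
  qed
  moreover have "(?tp + ?tm) div 2 \<le> v t i" if "i \<in> ?S" for i
  proof -
    have "?tp \<le> v t i" using that by (simp add: top_k_def)
    then show ?thesis using less by linarith
  qed
  moreover have "v t j \<le> (?tp + ?tm) div 2" if "j \<in> {1..n} - ?S" for j
    using le_kth_largest_Suc[OF inj k that] less by linarith
  moreover have "\<exists>i\<in>?S. \<exists>u\<in>{t..t}. ?tp = v u i"
    using kth_largest_attained[OF k(1) less_imp_le[OF k(2)], of "v t"]
    by (metis atLeastAtMost_iff order_refl)
  moreover have "\<exists>j\<in>{1..n} - ?S. \<exists>u\<in>{t..t}. ?tm = v u j"
    using kth_largest_Suc_attained[OF inj k] by (metis atLeastAtMost_iff order_refl)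
  moreover have "log 2 (real (?tp - ?tm + 1)) \<le> D + 1"
  proof -
    have gap: "1 \<le> ?tp - ?tm" "?tp - ?tm \<le> max_gap n k v T"
      using max_gap_ge[OF inst \<open>t \<le> T\<close>] by blast+
    have "log 2 (real (?tp - ?tm + 1)) \<le> log 2 (2 * real (max_gap n k v T))"
    proof (intro log_mono)
      \<comment> \<open>As the gap is at least \<open>1\<close>, adding \<open>1\<close> at most
        doubles it; this is the extra unit in \<open>D + 1\<close>.\<close>
      have "?tp - ?tm + 1 \<le> 2 * max_gap n k v T" using gap by linarith
      then show "real (?tp - ?tm + 1) \<le> 2 * real (max_gap n k v T)" by linarith
    qed auto
    also have "\<dots> = D + 1" using gap by (simp add: D log_mult)
    finally show ?thesis .
  qed
  ultimately show ?thesis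
    using less r w cost unfolding monitor_inv_def by (intro conjI ballI) auto
qed

text \<open>With no message after \<open>t0\<close>, the filters of time \<open>t0\<close> admit all
  values up to \<open>t1\<close>, and \<open>filters_separate\<close> applied to \<open>v u\<close>
  and \<open>v u'\<close> forbids the crossing. The message found lies after \<open>t0\<close>, so
  successive resets are charged to different messages.\<close>

lemma offline_run_message_if_crossing:
  assumes inst: "monitoring_instance n k v T" and run: "offline_run n k v T F ms" and "t1 \<le> T"
    and i: "i \<in> top_k n k (v t0)" "u \<in> {t0..t1}" and j: "j \<in> {1..n} - top_k n k (v t0)" "u' \<in> {t0..t1}"
    and less: "v u i < v u' j"
  shows "Suc (\<Sum>u\<le>t0. length (ms u)) \<le> (\<Sum>u\<le>t1. length (ms u))"
proof (rule ccontr)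
  assume few: "\<not> Suc (\<Sum>u\<le>t0. length (ms u)) \<le> (\<Sum>u\<le>t1. length (ms u))"
  have "t0 \<le> t1" using i(2) by simp
  then have "{..t1} = {..t0} \<union> {t0<..t1}" by auto
  then have "(\<Sum>u\<le>t1. length (ms u)) = (\<Sum>u\<le>t0. length (ms u)) + (\<Sum>u\<in>{t0<..t1}. length (ms u))"
    by (simp only:) (intro sum.union_disjoint; auto)
  with few have none: "(\<Sum>u\<in>{t0<..t1}. length (ms u)) = 0" by linarith
  have sof: "set_of_filters n k (v u) (F u)" if "u \<in> {t0..t1}" for u
    using run that \<open>t1 \<le> T\<close> by (simp add: offline_run_def)
  have inj: "inj_on (v u) {1..n}" if "u \<in> {t0..t1}" for u
    using inst that \<open>t1 \<le> T\<close> by (simp add: monitoring_instance_def)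
  have filt: "in_filter (v u i) (F t0 i)" if "u \<in> {t0..t1}" "i \<in> {1..n}" for u i
  proof -
    have "F u i = F t0 i"
      using offline_run_no_messages[OF run _ _ \<open>t1 \<le> T\<close> none that(2), of u] that(1) by simp
    moreover have "in_filter (v u i) (F u i)"
      using sof[OF that(1)] that(2) by (simp add: set_of_filters_def)
    ultimately show ?thesis by simp
  qed
  have "v u' j \<le> v u i"
    using sof[of t0] \<open>t0 \<le> t1\<close>
    by (intro filters_separate[OF _ inj[OF i(2)] filt[OF i(2)] inj[OF j(2)] filt[OF j(2)] i(1) j(1)]) simp
  with less show False by simp
qed

text \<open>The new interval lies strictly on one side of the midpoint of the old one. Adding
  \<open>1\<close> counts integers instead of length, which absorbs the rounding of the
  midpoint.\<close>

lemma gap_halves: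
  fixes a b c d :: nat
  assumes "c \<le> d" "d \<le> a" "b \<le> c" "d < (a + b) div 2 \<or> (a + b) div 2 < c"
  shows "2 * (d - c + 1) \<le> a - b + 1"
proof -
  obtain M where M: "(a + b) div 2 = M" "2 * M \<le> a + b" "a + b \<le> 2 * M + 1" by simp
  show ?thesis
    using assms(4) unfolding M(1)
  proof
    assume "d < M"
    then show ?thesis using assms(1-3) M(2,3) by simp
  next
    assume "M < c"
    then show ?thesis using assms(1-3) M(2,3) by simp
  qed
qed

text \<open>Without a violation the distribution is unchanged; a violation that keeps
  \<open>tm' \<le> tp'\<close> raises \<open>w\<close> and lowers the potential by one; otherwise a
  reset raises both \<open>r\<close> and \<open>w\<close>.\<close>

lemma monitor_inv_step:
  assumes inst: "monitoring_instance n k v T" and adm: "admissible_parameters n k N_top N_rest N_all"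
    and run: "offline_run n k v T F ms" and "Suc t \<le> T"
    and L: "nat \<lceil>log 2 (real N_top)\<rceil> \<le> L" "nat \<lceil>log 2 (real N_rest)\<rceil> \<le> L"
      "nat \<lceil>log 2 (real N_all)\<rceil> \<le> L"
    and D: "D = log 2 (real (max_gap n k v T))"
    and inv: "monitor_inv n k v ms (3 * Suc L) D t p S tp tm t0 r w"
  shows "\<exists>S tp tm t0 r w. monitor_inv n k v ms (3 * Suc L) D (Suc t)
    (bind_pmf p (monitor_step n k N_top N_rest N_all (v (Suc t)))) S tp tm t0 r w"
proof -
  let ?x = "v (Suc t)" and ?M = "(tp + tm) div 2" and ?P = "3 * Suc L"
  have k: "1 \<le> k" "k < n" and inj: "inj_on ?x {1..n}" and inj0: "inj_on (v t0) {1..n}"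
    using inst \<open>Suc t \<le> T\<close> inv by (auto simp: monitoring_instance_def monitor_inv_def)
  have supp: "top_set s = S" "T_plus s = tp" "T_minus s = tm" "mid s = ?M" if "s \<in> set_pmf p" for s
    using inv that unfolding monitor_inv_def by blast+
  have t0: "t0 \<le> t" and tm_tp: "tm \<le> tp" and top: "\<And>u. u \<in> {t0..t} \<Longrightarrow> top_k n k (v u) = S"
    and r: "r \<le> (\<Sum>u\<le>t0. length (ms u))"
    and pot: "real w + log 2 (real (tp - tm + 1)) \<le> real r * (D + 2)"
    and cost: "(\<integral>\<^sup>+s. of_nat (cost s) \<partial>p) \<le> of_nat (r * (Suc k * ?P + 1) + w * (3 * ?P + 1))"
    using inv unfolding monitor_inv_def by blast+
  obtain i0 u0 where i0: "i0 \<in> S" "u0 \<in> {t0..t}" "tp = v u0 i0"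
    using inv unfolding monitor_inv_def by blast
  obtain j0 u0' where j0: "j0 \<in> {1..n} - S" "u0' \<in> {t0..t}" "tm = v u0' j0"
    using inv unfolding monitor_inv_def by blast
  have S_top: "S = top_k n k (v t0)" using top[of t0] t0 by simp
  have S: "S \<subseteq> {1..n}" using top_k_subset[of n k "v t0"] by (simp only: S_top)
  have card_S: "card S = k" using card_top_k[OF inj0 k(1)] k(2) by (simp add: S_top)
  have fin: "finite S" using finite_subset[OF S] by simp
  show ?thesis
  proof (cases "(\<exists>i\<in>S. ?x i < ?M) \<or> (\<exists>j\<in>{1..n} - S. ?M < ?x j)")
    case False
    then have quiet: "\<And>i. i \<in> S \<Longrightarrow> ?M \<le> ?x i" "\<And>j. j \<in> {1..n} - S \<Longrightarrow> ?x j \<le> ?M"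
      by (auto simp: not_less)
    have "bind_pmf p (monitor_step n k N_top N_rest N_all ?x) = bind_pmf p return_pmf"
    proof (intro bind_pmf_cong refl)
      fix s assume s: "s \<in> set_pmf p"
      show "monitor_step n k N_top N_rest N_all ?x s = return_pmf s"
        by (rule monitor_step_quiet) (use supp[OF s] quiet in simp_all)
    qed
    also have "\<dots> = p" by (rule bind_return_pmf')
    finally have p_eq: "bind_pmf p (monitor_step n k N_top N_rest N_all ?x) = p" .
    have "top_k n k ?x = S"
      using set_of_filters_threshold(1)[OF S card_S k(1) less_imp_le[OF k(2)] inj quiet] .
    then have "top_k n k (v u) = S" if "u \<in> {t0..Suc t}" for u
      using top[of u] that by (cases "u = Suc t") auto
    moreover have "\<exists>i\<in>S. \<exists>u\<in>{t0..Suc t}. tp = v u i"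
      using i0 by (intro bexI[of _ i0] bexI[of _ u0]) auto
    moreover have "\<exists>j\<in>{1..n} - S. \<exists>u\<in>{t0..Suc t}. tm = v u j"
      using j0 by (intro bexI[of _ j0] bexI[of _ u0']) auto
    ultimately have "monitor_inv n k v ms ?P D (Suc t) p S tp tm t0 r w"
      using supp t0 tm_tp r pot cost quiet unfolding monitor_inv_def by (intro conjI ballI) simp_all
    then show ?thesis unfolding p_eq by blast
  next
    case True
    let ?p = "bind_pmf p (monitor_step n k N_top N_rest N_all ?x)"
    have "card ({1..n} - S) = n - k" using S card_S fin by (simp add: card_Diff_subset)
    then interpret monitor_violation n N_top N_rest ?x S ?M
      using S i0(1) j0(1) card_S inj True adm
      by unfold_locales (auto simp: admissible_parameters_def)
    have N_all: "n \<le> N_all" using adm by (simp add: admissible_parameters_def)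
    define tp' tm' where "tp' = next_T_plus ?x S tp" and "tm' = next_T_minus n ?x S tm"
    have support: "\<exists>s c. top_set s = S \<and> T_plus s = tp \<and> T_minus s = tm \<and>
        s' \<in> set_pmf (communicate n k N_all ?x s c)" if s': "s' \<in> set_pmf ?p" for s'
    proof -
      obtain s where s: "s \<in> set_pmf p" "s' \<in> set_pmf (monitor_step n k N_top N_rest N_all ?x s)"
        using s' by auto
      from monitor_step_support[OF supp(1,4)[OF s(1)] s(2)] show ?thesis
        using supp(1-3)[OF s(1)] by blast
    qed
    have cost_p: "(\<integral>\<^sup>+s. of_nat (cost s) \<partial>?p) \<le> of_nat (r * (Suc k * ?P + 1) + w * (3 * ?P + 1)) +
        of_nat (3 * ?P + 1 + (if tp' < tm' then Suc k * ?P + 1 else 0))"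
    proof (rule nn_integral_bind_pmf_le[OF _ cost])
      fix s assume s: "s \<in> set_pmf p"
      show "(\<integral>\<^sup>+s'. of_nat (cost s') \<partial>monitor_step n k N_top N_rest N_all ?x s) \<le> of_nat (cost s) +
          of_nat (3 * ?P + 1 + (if tp' < tm' then Suc k * ?P + 1 else 0))"
        using expected_cost_monitor_step[OF supp(1,4)[OF s] N_all L, of k]
        unfolding supp(2,3)[OF s] tp'_def tm'_def .
    qed
    have "Min (?x ` S) \<in> ?x ` S" using fin i0(1) by (intro Min_in) auto
    then obtain i1 where i1: "i1 \<in> S" "?x i1 = Min (?x ` S)" by auto
    have "Max (?x ` ({1..n} - S)) \<in> ?x ` ({1..n} - S)" using j0(1) by (intro Max_in) auto
    then obtain j1 where j1: "j1 \<in> {1..n} - S" "?x j1 = Max (?x ` ({1..n} - S))" by auto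
    \<comment> \<open>The updated bounds are values really observed since the last reset, as the
      offline crossing lemma requires.\<close>
    have "\<exists>i\<in>S. \<exists>u\<in>{t0..Suc t}. tp' = v u i"
    proof (cases "tp \<le> Min (?x ` S)")
      case True
      then show ?thesis
        using i0 by (intro bexI[of _ i0] bexI[of _ u0]) (auto simp: tp'_def next_T_plus_def)
    next
      case False
      then show ?thesis
        using i1 t0 by (intro bexI[of _ i1] bexI[of _ "Suc t"]) (auto simp: tp'_def next_T_plus_def)
    qed
    then obtain i u where i: "i \<in> S" "u \<in> {t0..Suc t}" "tp' = v u i" by blast
    have "\<exists>j\<in>{1..n} - S. \<exists>u\<in>{t0..Suc t}. tm' = v u j"
    proof (cases "Max (?x ` ({1..n} - S)) \<le> tm")
      case True
      then show ?thesis
        using j0 by (intro bexI[of _ j0] bexI[of _ u0']) (auto simp: tm'_def next_T_minus_def)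
    next
      case False
      then show ?thesis
        using j1 t0 by (intro bexI[of _ j1] bexI[of _ "Suc t"]) (auto simp: tm'_def next_T_minus_def)
    qed
    then obtain j u' where j: "j \<in> {1..n} - S" "u' \<in> {t0..Suc t}" "tm' = v u' j" by blast
    show ?thesis
    proof (cases "tp' < tm'")
      case True
      have "Suc r \<le> (\<Sum>u\<le>Suc t. length (ms u))"
        using offline_run_message_if_crossing[OF inst run \<open>Suc t \<le> T\<close>, of i t0 u j u'] i j True r
        by (simp add: S_top[symmetric])
      \<comment> \<open>The old potential is dropped as nonnegative; the new \<open>D + 2\<close>
        covers this violation and the potential after the reset.\<close>
      moreover have "real (Suc w) + D + 1 \<le> real (Suc r) * (D + 2)"
      proof -
        have "0 \<le> log 2 (real (tp - tm + 1))" by simp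
        then have "real w \<le> real r * (D + 2)" using pot by linarith
        then show ?thesis by (simp add: algebra_simps)
      qed
      moreover have "\<exists>c. s' \<in> set_pmf (filter_reset n k N_all ?x c)" if "s' \<in> set_pmf ?p" for s'
        using support[OF that] True by (auto simp: communicate_def tp'_def tm'_def)
      moreover have "(\<integral>\<^sup>+s. of_nat (cost s) \<partial>?p)
          \<le> of_nat (Suc r * (Suc k * ?P + 1) + Suc w * (3 * ?P + 1))"
      proof -
        have "of_nat (r * (Suc k * ?P + 1) + w * (3 * ?P + 1)) +
            of_nat (3 * ?P + 1 + (if tp' < tm' then Suc k * ?P + 1 else 0))
          = (of_nat (Suc r * (Suc k * ?P + 1) + Suc w * (3 * ?P + 1)) :: ennreal)"
          using True by (simp only: of_nat_add[symmetric] if_True) (simp add: algebra_simps)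
        then show ?thesis using cost_p by (simp only:)
      qed
      ultimately show ?thesis
        using monitor_inv_reset[OF inst \<open>Suc t \<le> T\<close> N_all _ D] by blast
    next
      case False
      let ?M' = "(tp' + tm') div 2"
      have tp'_le: "tp' \<le> tp" "\<And>i. i \<in> S \<Longrightarrow> tp' \<le> ?x i"
        using fin by (auto simp: tp'_def next_T_plus_def min_le_iff_disj)
      have tm'_ge: "tm \<le> tm'" "\<And>j. j \<in> {1..n} - S \<Longrightarrow> ?x j \<le> tm'"
        by (auto simp: tm'_def next_T_minus_def le_max_iff_disj)
      have quiet: "\<And>i. i \<in> S \<Longrightarrow> ?M' \<le> ?x i" "\<And>j. j \<in> {1..n} - S \<Longrightarrow> ?x j \<le> ?M'"
      proof -
        show "?M' \<le> ?x i" if "i \<in> S" for i using tp'_le(2)[OF that] False by linarith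
        show "?x j \<le> ?M'" if "j \<in> {1..n} - S" for j using tm'_ge(2)[OF that] False by linarith
      qed
      have "top_k n k ?x = S"
        using set_of_filters_threshold(1)[OF S(1) card_S k(1) less_imp_le[OF k(2)] inj quiet] .
      then have top': "top_k n k (v u) = S" if "u \<in> {t0..Suc t}" for u
        using top[of u] that by (cases "u = Suc t") auto
      have supp': "top_set s' = S \<and> T_plus s' = tp' \<and> T_minus s' = tm' \<and> mid s' = ?M'"
        if s': "s' \<in> set_pmf ?p" for s'
      proof -
        obtain s c where "top_set s = S" "T_plus s = tp" "T_minus s = tm"
            "s' \<in> set_pmf (communicate n k N_all ?x s c)"
          using support[OF s'] by blast
        with False show ?thesis
          unfolding tp'_def tm'_def by (simp add: communicate_def Let_def add.commute)
      qed
      \<comment> \<open>A violating value of the current step bounds \<open>tp'\<close> from above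
        or \<open>tm'\<close> from below.\<close>
      have "tp' < ?M \<or> ?M < tm'"
        using True tp'_le(2) tm'_ge(2) by (meson le_less_trans less_le_trans)
      then have "2 * (tp' - tm' + 1) \<le> tp - tm + 1"
        using gap_halves[OF _ tp'_le(1) tm'_ge(1)] False by simp
      then have "2 * real (tp' - tm' + 1) \<le> real (tp - tm + 1)" by linarith
      then have "log 2 (2 * real (tp' - tm' + 1)) \<le> log 2 (real (tp - tm + 1))"
        by (intro log_mono) auto
      moreover have "log 2 (2 * real (tp' - tm' + 1)) = 1 + log 2 (real (tp' - tm' + 1))"
        by (subst log_mult) auto
      ultimately have pot': "real (Suc w) + log 2 (real (tp' - tm' + 1)) \<le> real r * (D + 2)"
        using pot unfolding of_nat_Suc by linarith
      have cost': "(\<integral>\<^sup>+s. of_nat (cost s) \<partial>?p) \<le> of_nat (r * (Suc k * ?P + 1) + Suc w * (3 * ?P + 1))"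
      proof -
        have "of_nat (r * (Suc k * ?P + 1) + w * (3 * ?P + 1)) +
            of_nat (3 * ?P + 1 + (if tp' < tm' then Suc k * ?P + 1 else 0))
          = (of_nat (r * (Suc k * ?P + 1) + Suc w * (3 * ?P + 1)) :: ennreal)"
          using False by (simp only: of_nat_add[symmetric] if_False) (simp add: algebra_simps)
        then show ?thesis using cost_p by (simp only:)
      qed
      have "\<exists>i\<in>S. \<exists>u\<in>{t0..Suc t}. tp' = v u i" "\<exists>j\<in>{1..n} - S. \<exists>u\<in>{t0..Suc t}. tm' = v u j"
        using i j by blast+
      then have "monitor_inv n k v ms ?P D (Suc t) ?p S tp' tm' t0 r (Suc w)"
        unfolding monitor_inv_def using supp' t0 top' False quiet r pot' cost'
        by (intro conjI ballI) (simp_all only: not_less le_SucI)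
      then show ?thesis by blast
    qed
  qed
qed

lemma monitor_inv_monitor:
  assumes inst: "monitoring_instance n k v T" and adm: "admissible_parameters n k N_top N_rest N_all"
    and run: "offline_run n k v T F ms" and "t \<le> T"
    and L: "nat \<lceil>log 2 (real N_top)\<rceil> \<le> L" "nat \<lceil>log 2 (real N_rest)\<rceil> \<le> L"
      "nat \<lceil>log 2 (real N_all)\<rceil> \<le> L"
    and D: "D = log 2 (real (max_gap n k v T))"
  shows "\<exists>S tp tm t0 r w.
    monitor_inv n k v ms (3 * Suc L) D t (monitor n k N_top N_rest N_all v t) S tp tm t0 r w"
  using \<open>t \<le> T\<close>
proof (induction t)
  case 0
  have N_all: "n \<le> N_all" using adm by (simp add: admissible_parameters_def)
  have inj: "inj_on (v 0) {1..n}" using inst by (simp add: monitoring_instance_def)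
  \<comment> \<open>The initial reset counts as \<open>r = 1\<close> with no violation,
    \<open>w = 0\<close>.\<close>
  have "monitor_inv n k v ms (3 * Suc L) D 0 (filter_reset n k N_all (v 0) 0) (top_k n k (v 0))
      (kth_largest n k (v 0)) (kth_largest n (Suc k) (v 0)) 0 1 0"
  proof (rule monitor_inv_reset[OF inst 0 N_all _ D])
    show "1 \<le> (\<Sum>u\<le>0. length (ms u))" using offline_run_initial_message[OF inst run] by simp
    show "(\<integral>\<^sup>+s. of_nat (cost s) \<partial>filter_reset n k N_all (v 0) 0)
        \<le> of_nat (1 * (Suc k * (3 * Suc L) + 1) + 0 * (3 * (3 * Suc L) + 1))"
      using expected_cost_filter_reset[OF inj N_all L(3), of k 0]
      by (simp only: of_nat_0 add_0 mult_1 mult_0 add_0_right)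
  qed auto
  then show ?case unfolding monitor.simps by blast
next
  case (Suc t)
  then obtain S tp tm t0 r w where
    "monitor_inv n k v ms (3 * Suc L) D t (monitor n k N_top N_rest N_all v t) S tp tm t0 r w"
    by auto
  from monitor_inv_step[OF inst adm run Suc.prems L D this]
  show ?case unfolding monitor.simps .
qed

lemma monitor_correct:
  assumes inst: "monitoring_instance n k v T" and adm: "admissible_parameters n k N_top N_rest N_all"
    and "t \<le> T" "s \<in> set_pmf (monitor n k N_top N_rest N_all v t)"
  shows "top_set s = top_k n k (v t) \<and> set_of_filters n k (v t) (assigned_filter s)"
proof -
  \<comment> \<open>Correctness does not refer to an offline run, but the invariant does, so any run
    and any large enough \<open>L\<close> are supplied.\<close>
  obtain F ms where run: "offline_run n k v T F ms" using offline_run_exists[OF inst] by blast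
  define L where "L = nat \<lceil>log 2 (real N_top)\<rceil> + nat \<lceil>log 2 (real N_rest)\<rceil> + nat \<lceil>log 2 (real N_all)\<rceil>"
  have L: "nat \<lceil>log 2 (real N_top)\<rceil> \<le> L" "nat \<lceil>log 2 (real N_rest)\<rceil> \<le> L"
      "nat \<lceil>log 2 (real N_all)\<rceil> \<le> L"
    unfolding L_def by linarith+
  obtain S tp tm t0 r w where inv: "monitor_inv n k v ms (3 * Suc L) (log 2 (real (max_gap n k v T))) t
      (monitor n k N_top N_rest N_all v t) S tp tm t0 r w"
    using monitor_inv_monitor[OF inst adm run \<open>t \<le> T\<close> L refl] by blast
  have k: "1 \<le> k" "k < n" and inj: "inj_on (v t) {1..n}"
    using inst \<open>t \<le> T\<close> by (auto simp: monitoring_instance_def)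
  have s: "top_set s = S" "mid s = (tp + tm) div 2"
    using inv assms(4) unfolding monitor_inv_def by blast+
  have top: "top_k n k (v t) = S"
    using inv unfolding monitor_inv_def by (meson atLeastAtMost_iff order_refl)
  have S: "S \<subseteq> {1..n}" "card S = k"
    using top_k_subset[of n k "v t"] card_top_k[OF inj k(1)] k(2) by (simp_all add: top)
  have sep: "\<And>i. i \<in> S \<Longrightarrow> mid s \<le> v t i" "\<And>j. j \<in> {1..n} - S \<Longrightarrow> v t j \<le> mid s"
    using inv unfolding s(2) monitor_inv_def by blast+
  have "assigned_filter s = (\<lambda>i. if i \<in> S then (Fin (mid s), Pinf) else (Minf, Fin (mid s)))"
    by (simp add: fun_eq_iff assigned_filter_def s(1))
  then show ?thesis
    using set_of_filters_threshold(2)[OF S k(1) less_imp_le[OF k(2)] inj sep] s(1) top by simp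
qed

text \<open>Doubling the parameter adds one round; for \<open>N = 0\<close> the logarithm has the
  default value \<open>0\<close>.\<close>

lemma ceiling_log_le:
  assumes "1 \<le> n" "N \<le> 2 * n"
  shows "nat \<lceil>log 2 (real N)\<rceil> \<le> nat \<lceil>log 2 (real n)\<rceil> + 1"
proof (cases "N = 0")
  case False
  have "log 2 (real N) \<le> log 2 (2 * real n)"
    using assms False by (intro log_mono) auto
  also have "\<dots> = 1 + log 2 (real n)" using assms by (simp add: log_mult)
  finally have "\<lceil>log 2 (real N)\<rceil> \<le> \<lceil>log 2 (real n)\<rceil> + 1" by linarith
  then show ?thesis by linarith
qed (simp add: log_def)

lemma expected_cost_monitor:
  assumes inst: "monitoring_instance n k v T" and adm: "admissible_parameters n k N_top N_rest N_all"
  shows "measure_pmf.expectation (monitor n k N_top N_rest N_all v T) (\<lambda>s. real (cost s))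
    \<le> 132 * ((log 2 (real (max_gap n k v T)) + real k) * log 2 (real n)) * real (opt_messages n k v T)"
proof -
  have k: "1 \<le> k" "k < n" using inst by (auto simp: monitoring_instance_def)
  have "opt_messages n k v T \<in> {\<Sum>t\<le>T. length (ms t) | F ms. offline_run n k v T F ms}"
    unfolding opt_messages_def using offline_run_exists[OF inst] by (intro Inf_nat_def1) blast
  then obtain F ms where run: "offline_run n k v T F ms"
    and opt: "opt_messages n k v T = (\<Sum>t\<le>T. length (ms t))" by blast
  define D where "D = log 2 (real (max_gap n k v T))"
  define lg where "lg = log 2 (real n)"
  define L where "L = nat \<lceil>log 2 (real n)\<rceil> + 1"
  define P where "P = 3 * Suc L"
  have "nat \<lceil>log 2 (real N)\<rceil> \<le> L" if "N \<le> 2 * n" for N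
    using ceiling_log_le[OF _ that] k unfolding L_def by linarith
  then have L: "nat \<lceil>log 2 (real N_top)\<rceil> \<le> L" "nat \<lceil>log 2 (real N_rest)\<rceil> \<le> L"
      "nat \<lceil>log 2 (real N_all)\<rceil> \<le> L"
    using adm unfolding admissible_parameters_def by simp_all
  obtain S tp tm t0 r w where
    inv: "monitor_inv n k v ms P D T (monitor n k N_top N_rest N_all v T) S tp tm t0 r w"
    using monitor_inv_monitor[OF inst adm run order_refl L D_def] unfolding P_def by blast
  have "r \<le> (\<Sum>u\<le>t0. length (ms u))" "t0 \<le> T" using inv unfolding monitor_inv_def by blast+
  moreover have "(\<Sum>u\<le>t0. length (ms u)) \<le> (\<Sum>u\<le>T. length (ms u))"
    using \<open>t0 \<le> T\<close> by (intro sum_mono2) auto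
  ultimately have r: "real r \<le> real (opt_messages n k v T)" unfolding opt by linarith
  have "0 \<le> log 2 (real (tp - tm + 1))" by simp
  moreover have "real w + log 2 (real (tp - tm + 1)) \<le> real r * (D + 2)"
    using inv unfolding monitor_inv_def by blast
  ultimately have w: "real w \<le> real r * (D + 2)" by linarith
  have "1 \<le> max_gap n k v T" using max_gap_ge[OF inst order_refl] by linarith
  then have D: "0 \<le> D" by (simp add: D_def)
  have lg: "1 \<le> lg" using k by (simp add: lg_def le_log_iff)
  have "real L \<le> lg + 2" using lg unfolding L_def lg_def by linarith
  \<comment> \<open>\<open>P = 3 * (L + 1) \<le> 3 * lg + 9\<close>, and \<open>1 \<le> lg\<close>
    since \<open>n\<close> is at least \<open>2\<close>.\<close>
  then have P: "1 \<le> real P" "real P \<le> 12 * lg" using lg by (simp_all add: P_def)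
  \<comment> \<open>The bound on the nonnegative integral also shows that it is finite, so the real
    expectation is not a default value.\<close>
  have "measure_pmf.expectation (monitor n k N_top N_rest N_all v T) (\<lambda>s. real (cost s))
      = enn2real (\<integral>\<^sup>+s. of_nat (cost s) \<partial>monitor n k N_top N_rest N_all v T)"
    by (subst integral_eq_nn_integral) (auto simp: ennreal_of_nat_eq_real_of_nat)
  also have "\<dots> \<le> real (r * (Suc k * P + 1) + w * (3 * P + 1))"
  proof (rule enn2real_leI)
    show "(\<integral>\<^sup>+s. of_nat (cost s) \<partial>monitor n k N_top N_rest N_all v T)
        \<le> ennreal (real (r * (Suc k * P + 1) + w * (3 * P + 1)))"
      using inv unfolding monitor_inv_def ennreal_of_nat_eq_real_of_nat by blast
  qed simp
  also have "\<dots> = real r * ((real k + 1) * real P + 1) + real w * (3 * real P + 1)"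
    by (simp add: algebra_simps)
  also have "\<dots> \<le> real r * ((real k + 2) * real P) + real r * (D + 2) * (4 * real P)"
    using P(1) w D by (intro add_mono mult_mono) (auto simp: algebra_simps)
  also have "\<dots> = real r * (real P * (real k + 10 + 4 * D))"
    by (simp add: algebra_simps)
  \<comment> \<open>\<open>k + 10 + 4 * D \<le> 11 * (D + k)\<close> because
    \<open>1 \<le> k\<close>; with the factor \<open>12\<close> from \<open>P\<close> this gives
    \<open>132\<close>.\<close>
  also have "\<dots> \<le> real (opt_messages n k v T) * (12 * lg * (11 * (D + real k)))"
    using r P D lg k by (intro mult_mono mult_nonneg_nonneg) auto
  finally show ?thesis by (simp add: D_def lg_def algebra_simps)
qed

theorem theorem4:
  "\<exists>C::real. C > 0 \<and>
    (\<forall>(n::nat) (k::nat) (N_top::nat) (N_rest::nat) (N_all::nat) (v :: nat \<Rightarrow> nat \<Rightarrow> nat) (T::nat).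
      monitoring_instance n k v T \<and> admissible_parameters n k N_top N_rest N_all \<longrightarrow>
      (\<forall>t\<le>T. \<forall>s\<in>set_pmf (monitor n k N_top N_rest N_all v t).
         top_set s = top_k n k (v t) \<and> set_of_filters n k (v t) (assigned_filter s)) \<and>
      measure_pmf.expectation (monitor n k N_top N_rest N_all v T) (\<lambda>s. real (cost s))
        \<le> C * ((log 2 (real (max_gap n k v T)) + real k) * log 2 (real n))
          * real (opt_messages n k v T))"
proof (intro exI[of _ 132] conjI allI impI ballI)
qed (use monitor_correct expected_cost_monitor in auto)

end
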